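(* Let $G$ be a non-nested spinal graph. Then the $h^*$-polynomial of the flow polytope $\mathcal F_G$ is $$h^*_{\mathcal F_G}(z)=\sum_{\gamma\in\mathcal A_G}z^{\mathrm{des}(\pi(\gamma))}.$$
   Context: Spinal graph: a directed multigraph $G$ on vertex set $[n+1]=\{1,\dots,n+1\}$, all of whose edges $(i,i')$ go from a smaller vertex $i$ (the tail) to a larger vertex $i'$ (the head), containing at least one edge $(i,i+1)$ for each $i=1,\dots,n$. For each $i$ exactly one of the edges $(i,i+1)$ is designated the slack edge $x_i$; all other edges are non-slack. The $d$ non-slack edges are labeled $y_1,\dots,y_d$ in canonical order: increasing lexicographic order of the pairs (tail, head), with parallel edges ordered arbitrarily. $G$ is non-nested if there are no two non-slack edges $(i,j)$, $(k,l)$ with $i<k<l<j$. Flow polytope: $\mathcal F_G\subset\mathbb R^{E(G)}$ is the set of tuples $(f_e)_{e\in E(G)}$ of nonnegative reals such that for $i=1,\dots,n+1$, $a_i+\sum_{\mathrm{head}(e)=i}f_e=\sum_{\mathrm{tail}(e)=i}f_e$, where $\mathbf a=\mathbf e_1-\mathbf e_{n+1}$. It is a lattice polytope of dimension $d$. $h^*$-polynomial: for a $D$-dimensional lattice polytope $\mathcal P\subset\mathbb R^m$ and $t\ge1$ let $L_{\mathcal P}(t)=\#(t\mathcal P\cap\mathbb Z^m)$; then $h^*_{\mathcal P}(z)$ is the polynomial with $1+\sum_{t\ge1}L_{\mathcal P}(t)z^t=h^*_{\mathcal P}(z)/(1-z)^{D+1}$. Total cyclic order on a finite set $X$: a ternary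 relation $\gamma\subseteq X^3$ such that (a) $(x,y,z)\in\gamma\Rightarrow(y,z,x)\in\gamma$; (b) $(x,y,z)\in\gamma\Rightarrow(z,y,x)\notin\gamma$; (c) $(x,y,z),(x,z,u)\in\gamma\Rightarrow(x,y,u)\in\gamma$; (d) for all distinct $x,y,z$, $(x,y,z)\in\gamma$ or $(z,y,x)\in\gamma$. Equivalently, an arrangement of $X$ on a circle up to rotation, where $(x,y,z)\in\gamma$ means that reading clockwise from $x$ one meets $y$ before $z$. For $j\in[d]$, an index $k\in[j]$ is active at $j$ if $\mathrm{head}(y_k)\le\mathrm{tail}(y_j)$ and inactive at $j$ otherwise; $\mathrm{ACT}(j)$ is the set of active indices at $j$ together with $0$, and $\mathrm{INACT}(j)$ the set of inactive indices at $j$. For a total cyclic order $\gamma$ on $\{0,1,\dots,d\}$ let $\mathrm{skip}(j)=|\{z\in\mathrm{ACT}(j):(j-1,z,j)\in\gamma\}|$. $\gamma$ is a $G$-cyclic order if for all $j\in[d]$, $\sum_{k\in\mathrm{INACT}(j)}\mathrm{skip}(k)<|\mathrm{ACT}(j)|$. Let $\gamma|_j$ be the restriction of $\gamma$ to $\{0,\dots,j\}$. A $G$-cyclic order $\gamma$ is upper if for every $j\in[d]$, $j$ occurs in $\gamma|_j$ (clockwise) immediately before an element of $\mathrm{ACT}(j)$; it is lower if for every $j\in[d]$, $j$ occurs in $\gamma|_j$ immediately after $j-1$ or immediately after an element of $\mathrm{ACT}(j)$. For a non-nested $G$ the sets of upper and of lower $G$-cyclic orders coincide, and $\mathcal A_G$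 denotes this common set. $\pi(\gamma)$ is the permutation of $[d]$ (a word $\pi_1\cdots\pi_d$) obtained by reading the elements following $0$ in $\gamma$ clockwise; $\mathrm{des}(\pi)=\#\{i:\pi_i>\pi_{i+1}\}$. *)

theory Defs
  imports "HOL-Analysis.Analysis" "HOL-Computational_Algebra.Polynomial_FPS"
begin

text \<open>
  The edge set \<open>E(G)\<close> is the finite type \<open>'e\<close>, so that \<open>\<real>\<close> to the power \<open>E(G)\<close> is \<^typ>\<open>real ^ 'e\<close>.
  The field \<open>len\<close> is the number \<open>n\<close>, so the vertex set is \<open>{1..n+1}\<close>; \<open>slack i\<close> is the slack
  edge \<open>x\<^sub>i\<close> (only relevant for \<open>i \<in> {1..n}\<close>) and \<open>lab j\<close> is the non-slack edge \<open>y\<^sub>j\<close>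
  (only relevant for \<open>j \<in> {1..d}\<close>).
\<close>

record 'e spinal =
  len :: nat
  tail :: "'e \<Rightarrow> nat"
  head :: "'e \<Rightarrow> nat"
  slack :: "nat \<Rightarrow> 'e"
  lab :: "nat \<Rightarrow> 'e"

definition nonslack :: "'e::finite spinal \<Rightarrow> 'e set" where
  "nonslack G = - slack G ` {1..len G}"

definition num_nonslack :: "'e::finite spinal \<Rightarrow> nat" where
  "num_nonslack G = card (nonslack G)"

definition edge_lex_le :: "'e::finite spinal \<Rightarrow> 'e \<Rightarrow> 'e \<Rightarrow> bool" where
  "edge_lex_le G e e' \<longleftrightarrow>
     tail G e < tail G e' \<or> tail G e = tail G e' \<and> head G e \<le> head G e'"

definition canonical_labeling :: "'e::finite spinal \<Rightarrow> bool" where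
  "canonical_labeling G \<longleftrightarrow>
     bij_betw (lab G) {1..num_nonslack G} (nonslack G) \<and>
     (\<forall>j\<in>{1..num_nonslack G}. \<forall>k\<in>{1..num_nonslack G}.
        j \<le> k \<longrightarrow> edge_lex_le G (lab G j) (lab G k))"

definition spinal_graph :: "'e::finite spinal \<Rightarrow> bool" where
  "spinal_graph G \<longleftrightarrow>
     (\<forall>e. tail G e \<in> {1..len G + 1} \<and> head G e \<in> {1..len G + 1} \<and> tail G e < head G e) \<and>
     (\<forall>i\<in>{1..len G}. tail G (slack G i) = i \<and> head G (slack G i) = i + 1) \<and>
     canonical_labeling G"

definition non_nested :: "'e::finite spinal \<Rightarrow> bool" where
  "non_nested G \<longleftrightarrow>
     \<not> (\<exists>e\<in>nonslack G. \<exists>e'\<in>nonslack G.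
          tail G e < tail G e' \<and> tail G e' < head G e' \<and> head G e' < head G e)"


definition netflow :: "'e::finite spinal \<Rightarrow> nat \<Rightarrow> real" where
  "netflow G i = (if i = 1 then 1 else 0) - (if i = len G + 1 then 1 else 0)"

definition flow_polytope :: "'e::finite spinal \<Rightarrow> (real ^ 'e) set" where
  "flow_polytope G =
     {f. (\<forall>e. 0 \<le> f $ e) \<and>
         (\<forall>i\<in>{1..len G + 1}.
            netflow G i + (\<Sum>e | head G e = i. f $ e) = (\<Sum>e | tail G e = i. f $ e))}"

definition lattice_count :: "(real ^ 'e::finite) set \<Rightarrow> nat \<Rightarrow> nat" where
  "lattice_count P t = card {x \<in> (\<lambda>v. real t *\<^sub>R v) ` P. \<forall>e. x $ e \<in> \<int>}"

definition ehrhart_series :: "(real ^ 'e::finite) set \<Rightarrow> real fps" where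
  "ehrhart_series P = Abs_fps (\<lambda>t. if t = 0 then 1 else real (lattice_count P t))"

text \<open>
  A relation rather than a function, so that asserting it includes the existence of such a
  polynomial; it determines \<open>h\<close> by the lemma below.
\<close>

definition is_hstar_polynomial :: "(real ^ 'e::finite) set \<Rightarrow> real poly \<Rightarrow> bool" where
  "is_hstar_polynomial P h \<longleftrightarrow>
     ehrhart_series P = fps_of_poly h / (1 - fps_X) ^ nat (aff_dim P + 1)"

lemma is_hstar_polynomial_unique:
  assumes "is_hstar_polynomial P h" "is_hstar_polynomial P h'"
  shows "h = h'"
proof -
  let ?q = "(1 - fps_X) ^ nat (aff_dim P + 1) :: real fps"
  have q: "fps_nth ?q 0 \<noteq> 0"
    by simp
  have "fps_of_poly p = ehrhart_series P * ?q" if "is_hstar_polynomial P p" for p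
    using that fps_divide_unit[OF q] inverse_mult_eq_1[OF q]
    unfolding is_hstar_polynomial_def by (simp only: mult.assoc mult_1_right)
  hence "fps_of_poly h = fps_of_poly h'"
    using assms by simp
  thus ?thesis
    by simp
qed


definition total_cyclic_order :: "'a set \<Rightarrow> ('a \<times> 'a \<times> 'a) set \<Rightarrow> bool" where
  "total_cyclic_order X \<gamma> \<longleftrightarrow>
     \<gamma> \<subseteq> X \<times> X \<times> X \<and>
     (\<forall>x y z. (x, y, z) \<in> \<gamma> \<longrightarrow> (y, z, x) \<in> \<gamma>) \<and>
     (\<forall>x y z. (x, y, z) \<in> \<gamma> \<longrightarrow> (z, y, x) \<notin> \<gamma>) \<and>
     (\<forall>x y z u. (x, y, z) \<in> \<gamma> \<and> (x, z, u) \<in> \<gamma> \<longrightarrow> (x, y, u) \<in> \<gamma>) \<and>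
     (\<forall>x\<in>X. \<forall>y\<in>X. \<forall>z\<in>X. x \<noteq> y \<and> y \<noteq> z \<and> x \<noteq> z \<longrightarrow>
        (x, y, z) \<in> \<gamma> \<or> (z, y, x) \<in> \<gamma>)"

text \<open>\<open>x\<close> is immediately followed by \<open>y\<close> in the restriction of \<open>\<gamma>\<close> to \<open>X\<close>.\<close>

definition immediately_before ::
    "'a set \<Rightarrow> ('a \<times> 'a \<times> 'a) set \<Rightarrow> 'a \<Rightarrow> 'a \<Rightarrow> bool" where
  "immediately_before X \<gamma> x y \<longleftrightarrow>
     x \<in> X \<and> y \<in> X \<and> x \<noteq> y \<and> \<not> (\<exists>z\<in>X. (x, z, y) \<in> \<gamma>)"

definition ACT :: "'e::finite spinal \<Rightarrow> nat \<Rightarrow> nat set" where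
  "ACT G j = insert 0 {k\<in>{1..j}. head G (lab G k) \<le> tail G (lab G j)}"

definition INACT :: "'e::finite spinal \<Rightarrow> nat \<Rightarrow> nat set" where
  "INACT G j = {k\<in>{1..j}. \<not> head G (lab G k) \<le> tail G (lab G j)}"

definition skip :: "'e::finite spinal \<Rightarrow> (nat \<times> nat \<times> nat) set \<Rightarrow> nat \<Rightarrow> nat" where
  "skip G \<gamma> j = card {z \<in> ACT G j. (j - 1, z, j) \<in> \<gamma>}"

definition G_cyclic_order :: "'e::finite spinal \<Rightarrow> (nat \<times> nat \<times> nat) set \<Rightarrow> bool" where
  "G_cyclic_order G \<gamma> \<longleftrightarrow>
     total_cyclic_order {0..num_nonslack G} \<gamma> \<and>
     (\<forall>j\<in>{1..num_nonslack G}. (\<Sum>k\<in>INACT G j. skip G \<gamma> k) < card (ACT G j))"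

definition upper_cyclic_orders :: "'e::finite spinal \<Rightarrow> (nat \<times> nat \<times> nat) set set" where
  "upper_cyclic_orders G =
     {\<gamma>. G_cyclic_order G \<gamma> \<and>
          (\<forall>j\<in>{1..num_nonslack G}. \<exists>y\<in>ACT G j. immediately_before {0..j} \<gamma> j y)}"

definition lower_cyclic_orders :: "'e::finite spinal \<Rightarrow> (nat \<times> nat \<times> nat) set set" where
  "lower_cyclic_orders G =
     {\<gamma>. G_cyclic_order G \<gamma> \<and>
          (\<forall>j\<in>{1..num_nonslack G}.
             immediately_before {0..j} \<gamma> (j - 1) j \<or>
             (\<exists>y\<in>ACT G j. immediately_before {0..j} \<gamma> y j))}"

text \<open>
  For non-nested \<open>G\<close> this is also the set of lower \<open>G\<close>-cyclic orders; see
  \<open>upper_eq_lower_if_non_nested\<close> below.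
\<close>

definition common_cyclic_orders :: "'e::finite spinal \<Rightarrow> (nat \<times> nat \<times> nat) set set" where
  "common_cyclic_orders G = upper_cyclic_orders G"

text \<open>The permutation \<open>\<pi>(\<gamma>)\<close> for \<open>\<gamma>\<close> on \<open>{0..d}\<close>; well defined by \<open>cyclic_word_ex1\<close> below.\<close>

definition cyclic_word :: "nat \<Rightarrow> (nat \<times> nat \<times> nat) set \<Rightarrow> nat list" where
  "cyclic_word d \<gamma> =
     (THE w. distinct w \<and> set w = {1..d} \<and> sorted_wrt (\<lambda>x y. (0, x, y) \<in> \<gamma>) w)"

definition des :: "nat list \<Rightarrow> nat" where
  "des w = card {i. Suc i < length w \<and> w ! i > w ! Suc i}"


lemma
  assumes "total_cyclic_order X \<gamma>"
  shows tco_rot: "(x, y, z) \<in> \<gamma> \<Longrightarrow> (y, z, x) \<in> \<gamma>"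
    and tco_asym: "(x, y, z) \<in> \<gamma> \<Longrightarrow> (z, y, x) \<notin> \<gamma>"
    and tco_trans: "(x, y, z) \<in> \<gamma> \<Longrightarrow> (x, z, u) \<in> \<gamma> \<Longrightarrow> (x, y, u) \<in> \<gamma>"
    and tco_total: "x \<in> X \<Longrightarrow> y \<in> X \<Longrightarrow> z \<in> X \<Longrightarrow> x \<noteq> y \<Longrightarrow> y \<noteq> z \<Longrightarrow> x \<noteq> z \<Longrightarrow>
      (x, y, z) \<in> \<gamma> \<or> (x, z, y) \<in> \<gamma>"
    and tco_carrier: "(x, y, z) \<in> \<gamma> \<Longrightarrow> x \<in> X \<and> y \<in> X \<and> z \<in> X"
    and tco_distinct: "(x, y, z) \<in> \<gamma> \<Longrightarrow> x \<noteq> y \<and> y \<noteq> z \<and> x \<noteq> z"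
proof -
  have sub: "\<gamma> \<subseteq> X \<times> X \<times> X"
    and rot: "\<forall>x y z. (x, y, z) \<in> \<gamma> \<longrightarrow> (y, z, x) \<in> \<gamma>"
    and asym: "\<forall>x y z. (x, y, z) \<in> \<gamma> \<longrightarrow> (z, y, x) \<notin> \<gamma>"
    and trans: "\<forall>x y z u. (x, y, z) \<in> \<gamma> \<and> (x, z, u) \<in> \<gamma> \<longrightarrow> (x, y, u) \<in> \<gamma>"
    and total: "\<forall>x\<in>X. \<forall>y\<in>X. \<forall>z\<in>X. x \<noteq> y \<and> y \<noteq> z \<and> x \<noteq> z \<longrightarrow>
        (x, y, z) \<in> \<gamma> \<or> (z, y, x) \<in> \<gamma>"
    using assms unfolding total_cyclic_order_def by - ((elim conjE, assumption)+)
  show r: "(x, y, z) \<in> \<gamma> \<Longrightarrow> (y, z, x) \<in> \<gamma>" for x y z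
    by (rule rot[rule_format])
  show a: "(x, y, z) \<in> \<gamma> \<Longrightarrow> (z, y, x) \<notin> \<gamma>" for x y z
    by (rule asym[rule_format])
  show "(x, y, z) \<in> \<gamma> \<Longrightarrow> (x, z, u) \<in> \<gamma> \<Longrightarrow> (x, y, u) \<in> \<gamma>"
    by (rule trans[rule_format, OF conjI])
  show "(x, y, z) \<in> \<gamma> \<or> (x, z, y) \<in> \<gamma>"
    if "x \<in> X" "y \<in> X" "z \<in> X" "x \<noteq> y" "y \<noteq> z" "x \<noteq> z"
  proof -
    have "(x, y, z) \<in> \<gamma> \<or> (z, y, x) \<in> \<gamma>"
      using that total by simp
    thus ?thesis
      using r[OF r[of z y x]] by blast
  qed
  show "(x, y, z) \<in> \<gamma> \<Longrightarrow> x \<in> X \<and> y \<in> X \<and> z \<in> X"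
    using sub by auto
  show "x \<noteq> y \<and> y \<noteq> z \<and> x \<noteq> z" if xyz: "(x, y, z) \<in> \<gamma>"
    using xyz a[OF xyz] a[OF r[OF xyz]] a[OF r[OF r[OF xyz]]] r[OF xyz] r[OF r[OF xyz]] by auto
qed

lemma tco_asym': "total_cyclic_order X \<gamma> \<Longrightarrow> (x, y, z) \<in> \<gamma> \<Longrightarrow> (x, z, y) \<notin> \<gamma>"
  using tco_asym[of X \<gamma> x y z] tco_rot[of X \<gamma> x z y] by blast

lemma tco_drop:
  assumes "total_cyclic_order X \<gamma>" "(x, y, z) \<in> \<gamma>" "(x, z, u) \<in> \<gamma>"
  shows "(y, z, u) \<in> \<gamma>"
proof -
  note rot = tco_rot[OF assms(1)]
  have "(z, u, y) \<in> \<gamma>"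
    by (rule tco_trans[OF assms(1), OF rot[OF assms(3)] rot[OF rot[OF assms(2)]]])
  thus ?thesis
    by (rule rot[OF rot])
qed

lemma tco_card_less:
  assumes "total_cyclic_order X \<gamma>" "finite X" "(a, x, y) \<in> \<gamma>"
  shows "card {z. (a, z, x) \<in> \<gamma>} < card {z. (a, z, y) \<in> \<gamma>}"
proof (rule psubset_card_mono)
  show "finite {z. (a, z, y) \<in> \<gamma>}"
    by (rule finite_subset[OF _ assms(2)]) (auto dest: tco_carrier[OF assms(1)])
  show "{z. (a, z, x) \<in> \<gamma>} \<subset> {z. (a, z, y) \<in> \<gamma>}"
  proof (rule psubsetI)
    show "{z. (a, z, x) \<in> \<gamma>} \<subseteq> {z. (a, z, y) \<in> \<gamma>}"
      by (auto intro: tco_trans[OF assms(1) _ assms(3)])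
    have "x \<in> {z. (a, z, y) \<in> \<gamma>}" "x \<notin> {z. (a, z, x) \<in> \<gamma>}"
      using assms(3) tco_distinct[OF assms(1), of a x x] by auto
    thus "{z. (a, z, x) \<in> \<gamma>} \<noteq> {z. (a, z, y) \<in> \<gamma>}"
      by blast
  qed
qed

lemma cyclic_word_ex1:
  fixes d :: nat
  assumes "total_cyclic_order {0..d} \<gamma>"
  shows "\<exists>!w. distinct w \<and> set w = {1..d} \<and> sorted_wrt (\<lambda>x y. (0, x, y) \<in> \<gamma>) w"
proof -
  define f where "f x = card {z. (0, z, x) \<in> \<gamma>}" for x
  have less: "(0, x, y) \<in> \<gamma> \<longleftrightarrow> f x < f y" if "x \<in> {1..d}" "y \<in> {1..d}" for x y
  proof
    show "f x < f y" if "(0, x, y) \<in> \<gamma>"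
      unfolding f_def by (rule tco_card_less[OF assms _ that]) simp
    assume "f x < f y"
    moreover have "f y < f x" if "(0, y, x) \<in> \<gamma>"
      unfolding f_def by (rule tco_card_less[OF assms _ that]) simp
    ultimately show "(0, x, y) \<in> \<gamma>"
      using that tco_total[OF assms, of 0 x y] by (cases "x = y") auto
  qed
  have inj: "inj_on f {1..d}"
  proof (rule inj_onI)
    fix x y assume *: "x \<in> {1..d}" "y \<in> {1..d}" "f x = f y"
    show "x = y"
      using * less[of x y] less[of y x] tco_total[OF assms, of 0 x y] by auto
  qed
  have iff: "sorted_wrt (\<lambda>x y. (0, x, y) \<in> \<gamma>) w \<longleftrightarrow> sorted_wrt (<) (map f w)"
    if "set w = {1..d}" for w
    unfolding sorted_wrt_map
    by (rule iffI; erule sorted_wrt_mono_rel[rotated]) (use that less in auto)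
  show ?thesis
  proof (rule ex_ex1I)
    let ?w = "sort_key f [1..<Suc d]"
    have s: "set ?w = {1..d}" "distinct ?w"
      by auto
    moreover have "sorted_wrt (<) (map f ?w)"
      using s inj by (simp add: strict_sorted_iff distinct_map del: upt_Suc)
    ultimately show "\<exists>w. distinct w \<and> set w = {1..d} \<and> sorted_wrt (\<lambda>x y. (0, x, y) \<in> \<gamma>) w"
      using iff by blast
  next
    fix v w
    assume v: "distinct v \<and> set v = {1..d} \<and> sorted_wrt (\<lambda>x y. (0, x, y) \<in> \<gamma>) v"
      and w: "distinct w \<and> set w = {1..d} \<and> sorted_wrt (\<lambda>x y. (0, x, y) \<in> \<gamma>) w"
    have "map f v = map f w"
      using v w iff by (intro strict_sorted_equal) auto
    thus "v = w"
      using v w inj by (metis map_inj_on Un_absorb)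
  qed
qed

lemma finite_common_cyclic_orders: "finite (common_cyclic_orders G)"
  by (rule finite_subset[of _ "Pow ({0..num_nonslack G} \<times> {0..num_nonslack G} \<times> {0..num_nonslack G})"])
    (auto simp: common_cyclic_orders_def upper_cyclic_orders_def G_cyclic_order_def
      total_cyclic_order_def)

lemma ACT_INACT_if_non_nested:
  assumes "spinal_graph G" "non_nested G"
  obtains a where "\<And>j. j \<in> {1..num_nonslack G} \<Longrightarrow> 1 \<le> a j \<and> a j \<le> j"
    and "\<And>j. j \<in> {1..num_nonslack G} \<Longrightarrow> ACT G j = {0..<a j}"
    and "\<And>j. j \<in> {1..num_nonslack G} \<Longrightarrow> INACT G j = {a j..j}"
    and "\<And>i j. i \<in> {1..num_nonslack G} \<Longrightarrow> j \<in> {1..num_nonslack G} \<Longrightarrow> i \<le> j \<Longrightarrow> a i \<le> a j"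
proof -
  let ?d = "num_nonslack G" and ?t = "\<lambda>j. tail G (lab G j)" and ?h = "\<lambda>j. head G (lab G j)"
  define a where "a j = (LEAST k. 1 \<le> k \<and> ?h k > ?t j)" for j
  have ht: "?t j < ?h j" for j
    using assms(1) by (auto simp: spinal_graph_def)
  have mem: "lab G j \<in> nonslack G" if "j \<in> {1..?d}" for j
    using assms(1) that by (auto simp: spinal_graph_def canonical_labeling_def bij_betw_def)
  have lex: "edge_lex_le G (lab G j) (lab G k)" if "j \<in> {1..?d}" "k \<in> {1..?d}" "j \<le> k" for j k
    using assms(1) that by (auto simp: spinal_graph_def canonical_labeling_def)
  have tmono: "?t j \<le> ?t k" if "j \<in> {1..?d}" "k \<in> {1..?d}" "j \<le> k" for j k
    using lex[OF that] by (auto simp: edge_lex_le_def)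
  have hmono: "?h j \<le> ?h k" if "j \<in> {1..?d}" "k \<in> {1..?d}" "j \<le> k" for j k
    using lex[OF that] mem[OF that(1)] mem[OF that(2)] ht[of k] assms(2)
    unfolding edge_lex_le_def non_nested_def by (meson not_le)
  have a: "1 \<le> a j \<and> ?h (a j) > ?t j" "a j \<le> j" if "j \<in> {1..?d}" for j
  proof -
    have "1 \<le> j \<and> ?h j > ?t j"
      using that ht[of j] by simp
    thus "1 \<le> a j \<and> ?h (a j) > ?t j" "a j \<le> j"
      unfolding a_def by (rule LeastI) (rule Least_le, fact)
  qed
  have a_le: "a j \<le> k" if "1 \<le> k" "?h k > ?t j" for j k
    unfolding a_def using that by (intro Least_le) auto
  have key: "?h k > ?t j \<longleftrightarrow> a j \<le> k" if "j \<in> {1..?d}" "k \<in> {1..j}" for j k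
    using that a[of j] a_le[of k j] hmono[of "a j" k] by fastforce
  show thesis
  proof
    fix j assume j: "j \<in> {1..?d}"
    show "1 \<le> a j \<and> a j \<le> j"
      using a[OF j] by simp
    show "ACT G j = {0..<a j}"
      using a[OF j] key[OF j] by (fastforce simp: ACT_def not_less[symmetric])
    show "INACT G j = {a j..j}"
      using a[OF j] key[OF j] by (fastforce simp: INACT_def not_le)
  next
    fix i j assume ij: "i \<in> {1..?d}" "j \<in> {1..?d}" "i \<le> j"
    show "a i \<le> a j"
      using a[OF ij(2)] tmono[OF ij] a_le[of "a j" i] by simp
  qed
qed

lemma inactive_in_clockwise_order:
  fixes a :: "nat \<Rightarrow> nat"
  assumes \<gamma>: "G_cyclic_order G \<gamma>"
    and a: "\<And>j. j \<in> {1..num_nonslack G} \<Longrightarrow> 1 \<le> a j \<and> a j \<le> j"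
    and act: "\<And>j. j \<in> {1..num_nonslack G} \<Longrightarrow> ACT G j = {0..<a j}"
    and inact: "\<And>j. j \<in> {1..num_nonslack G} \<Longrightarrow> INACT G j = {a j..j}"
    and mono: "\<And>i j. i \<in> {1..num_nonslack G} \<Longrightarrow> j \<in> {1..num_nonslack G} \<Longrightarrow> i \<le> j \<Longrightarrow> a i \<le> a j"
  shows "j \<in> {1..num_nonslack G} \<Longrightarrow> a j - 1 \<le> u \<Longrightarrow> u < v \<Longrightarrow> v < w \<Longrightarrow> w \<le> j \<Longrightarrow> (u, v, w) \<in> \<gamma>"
proof (induction j arbitrary: u v w rule: less_induct)
  case (less j)
  let ?d = "num_nonslack G"
  define b where "b = a j - 1"
  have tco: "total_cyclic_order {0..?d} \<gamma>"
    using \<gamma> by (simp add: G_cyclic_order_def)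
  note rot = tco_rot[OF tco] and asym = tco_asym'[OF tco] and trans = tco_trans[OF tco]
    and total = tco_total[OF tco]
  have j: "j \<in> {1..?d}" "1 \<le> a j" "a j \<le> j"
    using less.prems a by auto
  have IH: "(x, y, z) \<in> \<gamma>" if "a i - 1 \<le> x" "x < y" "y < z" "z \<le> i" "i < j" for i x y z
    using less.IH[of i x y z] that j(1) by auto
  have IH': "(x, y, z) \<in> \<gamma>" if "b \<le> x" "x < y" "y < z" "z < j" for x y z
  proof (rule IH[of "j - 1"])
    have "j - 1 \<in> {1..?d}"
      using that j(1) by auto
    hence "a (j - 1) \<le> a j"
      using mono[of "j - 1" j] j(1) by simp
    thus "a (j - 1) - 1 \<le> x"
      using that by (simp add: b_def)
  qed (use that in auto)
  have step: "(b, j - 1, j) \<in> \<gamma>" if bj: "b < j - 1"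
  proof (rule ccontr)
    assume "(b, j - 1, j) \<notin> \<gamma>"
    hence neg: "(b, j, j - 1) \<in> \<gamma>"
      using total[of b "j - 1" j] bj j by auto
    have *: "\<exists>k\<in>{a j..j}. z < a k \<and> (k - 1, z, k) \<in> \<gamma>" if z: "z < a j" for z
    proof (cases "z = b \<or> (j - 1, z, j) \<in> \<gamma>")
      case True
      thus ?thesis
        using z j rot[OF rot[OF neg]] by (intro bexI[of _ j]) auto
    next
      case False
      hence zb: "z < b"
        using z by (auto simp: b_def)
      have "(j - 1, j, z) \<in> \<gamma>"
        using False total[of "j - 1" z j] zb bj j by auto
      hence bz: "(b, z, j - 1) \<in> \<gamma>"
        by (intro rot[OF trans[OF rot[OF rot[OF neg]]]])
      define m where "m = (LEAST m. a j \<le> m \<and> (b, z, m) \<in> \<gamma>)"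
      have ex: "a j \<le> j - 1 \<and> (b, z, j - 1) \<in> \<gamma>"
        using bz bj by (auto simp: b_def)
      have m: "a j \<le> m" "(b, z, m) \<in> \<gamma>"
        using LeastI[of "\<lambda>m. a j \<le> m \<and> (b, z, m) \<in> \<gamma>", OF ex] by (auto simp: m_def)
      have mj: "m \<le> j - 1"
        unfolding m_def by (rule Least_le) (rule ex)
      have m1: "(m - 1, z, m) \<in> \<gamma>"
      proof (cases "m = a j")
        case True
        thus ?thesis using m by (simp add: b_def)
      next
        case False
        hence "\<not> (a j \<le> m - 1 \<and> (b, z, m - 1) \<in> \<gamma>)"
          using not_less_Least[of "m - 1" "\<lambda>m. a j \<le> m \<and> (b, z, m) \<in> \<gamma>"] m j
          unfolding m_def[symmetric] by auto
        hence "(b, m - 1, z) \<in> \<gamma>"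
          using False m(1) total[of b z "m - 1"] zb bj j mj by (auto simp: b_def)
        thus ?thesis
          by (rule tco_drop[OF tco _ m(2)])
      qed
      have "z < a m"
      proof (rule ccontr)
        assume "\<not> z < a m"
        hence "(z, m - 1, m) \<in> \<gamma>"
          using IH[of m z "m - 1" m] zb m(1) mj j by (auto simp: b_def)
        thus False
          using asym[OF m1] rot[of z "m - 1" m] by simp
      qed
      thus ?thesis
        using m m1 mj by (intro bexI[of _ m]) auto
    qed
    have "{0..<a j} \<subseteq> (\<Union>k\<in>{a j..j}. {z \<in> ACT G k. (k - 1, z, k) \<in> \<gamma>})"
    proof (rule subsetI)
      fix z assume z: "z \<in> {0..<a j}"
      then obtain k where k: "k \<in> {a j..j}" "z < a k" "(k - 1, z, k) \<in> \<gamma>"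
        using *[of z] by auto
      hence "z \<in> ACT G k"
        using act[of k] j by auto
      thus "z \<in> (\<Union>k\<in>{a j..j}. {z \<in> ACT G k. (k - 1, z, k) \<in> \<gamma>})"
        using k by blast
    qed
    hence "card {0..<a j} \<le> card (\<Union>k\<in>{a j..j}. {z \<in> ACT G k. (k - 1, z, k) \<in> \<gamma>})"
      by (intro card_mono) (auto simp: ACT_def)
    also have "\<dots> \<le> (\<Sum>k\<in>{a j..j}. skip G \<gamma> k)"
      unfolding skip_def by (rule card_UN_le) simp
    also have "\<dots> < card (ACT G j)"
      using \<gamma> j(1) unfolding G_cyclic_order_def inact[OF j(1), symmetric] by blast
    finally show False
      using act[OF j(1)] by simp
  qed
  show ?case
  proof (cases "w = j")
    case False
    thus ?thesis
      using IH' less.prems by (auto simp: b_def)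
  next
    case w: True
    have bw: "(b, x, j) \<in> \<gamma>" if "b < x" "x < j" for x
    proof (cases "x = j - 1")
      case True
      thus ?thesis
        using that step by simp
    next
      case False
      hence "(b, x, j - 1) \<in> \<gamma>" "(b, j - 1, j) \<in> \<gamma>"
        using that IH'[of b x "j - 1"] step by auto
      thus ?thesis
        by (rule trans)
    qed
    show ?thesis
    proof (cases "u = b")
      case True
      thus ?thesis using bw less.prems w by auto
    next
      case False
      hence "(b, u, v) \<in> \<gamma>" "(b, v, j) \<in> \<gamma>"
        using bw IH' less.prems w by (auto simp: b_def)
      thus ?thesis
        unfolding w by (rule tco_drop[OF tco])
    qed
  qed
qed

lemma ex_immediate_successor:
  assumes tco: "total_cyclic_order X \<gamma>" and fin: "finite X" and Y: "Y \<subseteq> X" "x \<in> Y" "Y \<noteq> {x}"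
  shows "\<exists>y. immediately_before Y \<gamma> x y" "\<exists>y. immediately_before Y \<gamma> y x"
proof -
  define f where "f y = card {z. (x, z, y) \<in> \<gamma>}" for y
  have finY: "finite (Y - {x})" "Y - {x} \<noteq> {}"
    using Y fin finite_subset by auto
  obtain y where y: "y \<in> Y - {x}" "\<And>z. z \<in> Y - {x} \<Longrightarrow> f y \<le> f z"
    using arg_min_if_finite[OF finY, of f] by (meson not_le)
  have "(x, z, y) \<notin> \<gamma>" if "z \<in> Y" for z
    using y(2)[of z] that tco_card_less[OF tco fin, of x z y] tco_distinct[OF tco, of x z y]
    by (fastforce simp: f_def)
  thus "\<exists>y. immediately_before Y \<gamma> x y"
    using y Y by (auto simp: immediately_before_def)
  obtain y where y: "y \<in> Y - {x}" "\<And>z. z \<in> Y - {x} \<Longrightarrow> f z \<le> f y"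
    using finY Max_in[of "f ` (Y - {x})"] Max_ge[of "f ` (Y - {x})"] by fastforce
  have "(y, z, x) \<notin> \<gamma>" if "z \<in> Y" for z
  proof
    assume "(y, z, x) \<in> \<gamma>"
    hence "(x, y, z) \<in> \<gamma>" "z \<noteq> x"
      using tco_rot[OF tco, OF tco_rot[OF tco, of y z x]] tco_distinct[OF tco, of y z x] by blast+
    thus False
      using y(2)[of z] that tco_card_less[OF tco fin, of x y z] by (auto simp: f_def)
  qed
  thus "\<exists>y. immediately_before Y \<gamma> y x"
    using y Y by (auto simp: immediately_before_def)
qed

lemma upper_eq_lower_if_non_nested:
  assumes "spinal_graph G" "non_nested G"
  shows "upper_cyclic_orders G = lower_cyclic_orders G"
proof -
  let ?d = "num_nonslack G"
  obtain a where a: "\<And>j. j \<in> {1..?d} \<Longrightarrow> 1 \<le> a j \<and> a j \<le> j"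
    "\<And>j. j \<in> {1..?d} \<Longrightarrow> ACT G j = {0..<a j}"
    "\<And>j. j \<in> {1..?d} \<Longrightarrow> INACT G j = {a j..j}"
    "\<And>i j. i \<in> {1..?d} \<Longrightarrow> j \<in> {1..?d} \<Longrightarrow> i \<le> j \<Longrightarrow> a i \<le> a j"
    using ACT_INACT_if_non_nested[OF assms] by metis
  have "(\<exists>y\<in>ACT G j. immediately_before {0..j} \<gamma> j y) \<and>
      (immediately_before {0..j} \<gamma> (j - 1) j \<or> (\<exists>y\<in>ACT G j. immediately_before {0..j} \<gamma> y j))"
    if \<gamma>: "G_cyclic_order G \<gamma>" and j: "j \<in> {1..?d}" for \<gamma> j
  proof -
    have tco: "total_cyclic_order {0..?d} \<gamma>"
      using \<gamma> by (simp add: G_cyclic_order_def)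
    note clock = inactive_in_clockwise_order[OF \<gamma> a j]
    have "{0..j} \<subseteq> {0..?d}" "j \<in> {0..j}" "{0..j} \<noteq> {j}"
      using j by auto
    then obtain s p where s: "immediately_before {0..j} \<gamma> j s"
      and p: "immediately_before {0..j} \<gamma> p j"
      using ex_immediate_successor[OF tco, of "{0..j}" j] by blast
    have "s < a j"
    proof (rule ccontr)
      assume "\<not> s < a j"
      hence "(a j - 1, s, j) \<in> \<gamma>"
        by (intro clock) (use s a(1)[OF j] in \<open>auto simp: immediately_before_def\<close>)
      hence "(j, a j - 1, s) \<in> \<gamma>"
        using tco_rot[OF tco] by blast
      thus False
        using s a(1)[OF j] by (auto simp: immediately_before_def)
    qed
    moreover have "p < a j \<or> p = j - 1"
    proof (rule ccontr)
      assume *: "\<not> (p < a j \<or> p = j - 1)"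
      have "(p, j - 1, j) \<in> \<gamma>"
        by (intro clock) (use p a(1)[OF j] * in \<open>auto simp: immediately_before_def\<close>)
      thus False
        using p by (auto simp: immediately_before_def)
    qed
    ultimately show ?thesis
      using s p a(2)[OF j] by auto
  qed
  thus ?thesis
    unfolding upper_cyclic_orders_def lower_cyclic_orders_def by blast
qed

end

theory Submission
  imports Defs
begin

text \<open>
  Every slack coordinate of a flow is determined by the cut through its tail, so the lattice points
  of the \<open>t\<close>-th dilate are the \<open>y \<in> \<nat>\<^sup>d\<close> all of whose window sums
  \<open>y\<^sub>k + \<dots> + y\<^sub>j\<close>, \<open>k = min INACT(j)\<close>, are at most \<open>t\<close>. Put
  \<open>c\<^sub>k = (y\<^sub>1 + \<dots> + y\<^sub>k) mod (t + 1)\<close>; the modulus \<open>t + 1\<close>, rather than \<open>t\<close>, makes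
  \<open>y \<mapsto> c\<close> a bijection of the words over \<open>{0..t}\<close>. A window sum is at most \<open>t\<close> iff the prefix sums go
  around the circle \<open>\<int>/(t+1)\<close> less than once, i.e. iff the positions of the window occur clockwise
  in the cyclic order given by \<open>c\<close>, ties being broken by position. These clockwise conditions
  characterise \<open>\<A>\<^sub>G\<close>. The words \<open>c\<close> with cyclic order \<open>\<gamma>\<close> are those that increase weakly along \<open>\<pi>(\<gamma>)\<close>,
  and strictly at its descents; there are \<open>(t + d - des choose d)\<close> of them, with generating
  function \<open>z\<^bsup>des\<^esup> / (1 - z)\<^bsup>d+1\<^esup>\<close>.
\<close>

section \<open>The cyclic order of a word\<close>

text \<open>The index serves as a tie-break, so this is a strict total order even where
  \<open>c\<close> repeats a value. If \<open>c 0 = 0\<close>, then 0 is its least element.\<close>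

definition key_less :: "(nat \<Rightarrow> nat) \<Rightarrow> nat \<Rightarrow> nat \<Rightarrow> bool" where
  "key_less c x y \<longleftrightarrow> c x < c y \<or> c x = c y \<and> x < y"

lemma key_less_trans: "key_less c x y \<Longrightarrow> key_less c y z \<Longrightarrow> key_less c x z"
  by (auto simp: key_less_def)

lemma key_less_asym: "key_less c x y \<Longrightarrow> \<not> key_less c y x"
  by (auto simp: key_less_def)

lemma key_less_total: "x \<noteq> y \<Longrightarrow> key_less c x y \<or> key_less c y x"
  by (auto simp: key_less_def)

text \<open>The three disjuncts are the rotations of an increasing chain: the linear order
  \<open>key_less c\<close> bent into a circle.\<close>

definition word_cyclic_order :: "nat \<Rightarrow> (nat \<Rightarrow> nat) \<Rightarrow> (nat \<times> nat \<times> nat) set" where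
  "word_cyclic_order d c =
     {(x, y, z). x \<le> d \<and> y \<le> d \<and> z \<le> d \<and>
        (key_less c x y \<and> key_less c y z \<or> key_less c y z \<and> key_less c z x \<or>
         key_less c z x \<and> key_less c x y)}"

lemma total_cyclic_order_word: "total_cyclic_order {0..d} (word_cyclic_order d c)"
  unfolding total_cyclic_order_def
proof (intro conjI allI ballI impI)
  show "word_cyclic_order d c \<subseteq> {0..d} \<times> {0..d} \<times> {0..d}"
    by (auto simp: word_cyclic_order_def)
next
  fix x y z assume "(x, y, z) \<in> word_cyclic_order d c"
  thus "(y, z, x) \<in> word_cyclic_order d c"
    by (auto simp: word_cyclic_order_def)
next
  fix x y z assume "(x, y, z) \<in> word_cyclic_order d c"
  thus "(z, y, x) \<notin> word_cyclic_order d c"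
    by (auto simp: word_cyclic_order_def dest: key_less_asym)
next
  fix x y z u
  assume "(x, y, z) \<in> word_cyclic_order d c \<and> (x, z, u) \<in> word_cyclic_order d c"
  thus "(x, y, u) \<in> word_cyclic_order d c"
    by (simp add: word_cyclic_order_def) (meson key_less_asym key_less_trans)
next
  fix x y z assume "x \<in> {0..d}" "y \<in> {0..d}" "z \<in> {0..d}" "x \<noteq> y \<and> y \<noteq> z \<and> x \<noteq> z"
  thus "(x, y, z) \<in> word_cyclic_order d c \<or> (z, y, x) \<in> word_cyclic_order d c"
    using key_less_total[of x y c] key_less_total[of y z c] key_less_total[of x z c]
    by (auto simp: word_cyclic_order_def)
qed

lemma word_cyclic_order_from_0:
  assumes "c 0 = 0" "x \<in> {1..d}" "y \<in> {1..d}"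
  shows "(0, x, y) \<in> word_cyclic_order d c \<longleftrightarrow> key_less c x y"
  using assms by (auto simp: word_cyclic_order_def key_less_def)

text \<open>Cutting the circle at 0 loses nothing: every triple is, up to rotation, a chain read off
  after 0. Used in both directions, this yields equality of cyclic orders.\<close>

lemma total_cyclic_order_subset:
  fixes d :: nat
  assumes g: "total_cyclic_order {0..d} \<gamma>" and g': "total_cyclic_order {0..d} \<gamma>'"
    and eq: "\<And>x y. x \<in> {1..d} \<Longrightarrow> y \<in> {1..d} \<Longrightarrow> (0, x, y) \<in> \<gamma> \<Longrightarrow> (0, x, y) \<in> \<gamma>'"
  shows "\<gamma> \<subseteq> \<gamma>'"
proof
  note rot = tco_rot[OF g] and rot' = tco_rot[OF g']
  fix p assume "p \<in> \<gamma>"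
  then obtain x y z where p: "p = (x, y, z)" and xyz: "(x, y, z) \<in> \<gamma>"
    by (cases p) auto
  have le: "x \<in> {0..d}" "y \<in> {0..d}" "z \<in> {0..d}" and ne: "x \<noteq> y" "y \<noteq> z" "x \<noteq> z"
    using tco_carrier[OF g xyz] tco_distinct[OF g xyz] by auto
  have eq0: "(0, u, v) \<in> \<gamma>'" if "(0, u, v) \<in> \<gamma>" for u v
    using eq[OF _ _ that] tco_carrier[OF g that] tco_distinct[OF g that] by auto
  have "(x, y, z) \<in> \<gamma>'"
  proof (cases "x = 0 \<or> y = 0 \<or> z = 0")
    case True
    thus ?thesis
      using eq0[of y z] eq0[of z x] eq0[of x y] rot'[of x y z] rot'[of y z x] rot'[of z x y]
        rot[OF xyz] rot[OF rot[OF xyz]] xyz by auto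
  next
    case False
    have chain: "(u, v, w) \<in> \<gamma> \<and> (u, v, w) \<in> \<gamma>'" if "(0, u, v) \<in> \<gamma>" "(0, v, w) \<in> \<gamma>" for u v w
      using tco_drop[OF g that] tco_drop[OF g' eq0[OF that(1)] eq0[OF that(2)]] by blast
    have tot: "(0, u, v) \<in> \<gamma> \<or> (0, v, u) \<in> \<gamma>" if "u \<in> {0..d}" "v \<in> {0..d}" "u \<noteq> v" "u \<noteq> 0" "v \<noteq> 0" for u v
      using tco_total[OF g, of 0 u v] that by auto
    \<comment> \<open>Of the six linear orders of \<open>x\<close>, \<open>y\<close>,
      \<open>z\<close> after 0, three would induce the reversed triple; excluding them leaves the
      three rotations of \<open>x\<close>, \<open>y\<close>, \<open>z\<close>.\<close>
    have "(x, z, y) \<notin> \<gamma>" "(z, y, x) \<notin> \<gamma>" "(y, x, z) \<notin> \<gamma>"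
      using tco_asym[OF g xyz] tco_asym'[OF g xyz] rot by blast+
    hence "(0, x, y) \<in> \<gamma> \<and> (0, y, z) \<in> \<gamma> \<or> (0, y, z) \<in> \<gamma> \<and> (0, z, x) \<in> \<gamma> \<or>
        (0, z, x) \<in> \<gamma> \<and> (0, x, y) \<in> \<gamma>"
      using tot[OF le(1,2)] tot[OF le(2,3)] tot[OF le(1,3)] ne False
        chain[of x z y] chain[of z y x] chain[of y x z] by auto
    thus ?thesis
      using chain[of x y z] chain[of y z x] chain[of z x y] rot' by blast
  qed
  thus "p \<in> \<gamma>'"
    by (simp add: p)
qed

lemma cyclic_word_props:
  fixes d :: nat
  assumes "total_cyclic_order {0..d} \<gamma>"
  shows "distinct (cyclic_word d \<gamma>)" "set (cyclic_word d \<gamma>) = {1..d}"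
    "sorted_wrt (\<lambda>x y. (0, x, y) \<in> \<gamma>) (cyclic_word d \<gamma>)"
  using theI'[OF cyclic_word_ex1[OF assms]] unfolding cyclic_word_def by auto

text \<open>Both cyclic orders are determined by their linear orders after 0, so it is enough that
  \<open>key_less c\<close> lists \<open>{1..d}\<close> in the sequence \<pi>(\<gamma>). This
  describes the fibres of \<open>word_cyclic_order d\<close>.\<close>

lemma word_cyclic_order_eq_iff:
  assumes g: "total_cyclic_order {0..d} \<gamma>" and c: "c 0 = 0"
  shows "word_cyclic_order d c = \<gamma> \<longleftrightarrow> sorted_wrt (key_less c) (cyclic_word d \<gamma>)"
proof
  let ?w = "cyclic_word d \<gamma>"
  note w = cyclic_word_props[OF g]
  show "sorted_wrt (key_less c) ?w" if "word_cyclic_order d c = \<gamma>"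
    by (rule sorted_wrt_mono_rel[OF _ w(3)])
      (use word_cyclic_order_from_0[of c] c w(2) that in auto)
  assume s: "sorted_wrt (key_less c) ?w"
  have "(0, x, y) \<in> word_cyclic_order d c \<longleftrightarrow> (0, x, y) \<in> \<gamma>" if xy: "x \<in> {1..d}" "y \<in> {1..d}" for x y
  proof (cases "x = y")
    case True
    thus ?thesis
      using tco_distinct[OF g] tco_distinct[OF total_cyclic_order_word] by blast
  next
    case False
    obtain i j where ij: "i < length ?w" "j < length ?w" "?w ! i = x" "?w ! j = y"
      using xy w(2) by (metis in_set_conv_nth)
    consider "i < j" | "j < i"
      using False ij by (metis linorder_neqE_nat)
    thus ?thesis
    proof cases
      case 1
      thus ?thesis
        using sorted_wrt_nth_less[OF s 1] sorted_wrt_nth_less[OF w(3) 1] ij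
          word_cyclic_order_from_0[of c, OF c xy] by auto
    next
      case 2
      thus ?thesis
        using sorted_wrt_nth_less[OF s 2] sorted_wrt_nth_less[OF w(3) 2] ij tco_asym'[OF g]
          word_cyclic_order_from_0[of c, OF c xy] key_less_asym by auto
    qed
  qed
  thus "word_cyclic_order d c = \<gamma>"
    by (intro equalityI total_cyclic_order_subset[OF g total_cyclic_order_word]
        total_cyclic_order_subset[OF total_cyclic_order_word g]) auto
qed

section \<open>Words with a given sorting permutation\<close>

lemma des_Nil: "des [] = 0" and des_single: "des [a] = 0"
  by (auto simp: des_def)

lemma des_Cons:
  assumes "w \<noteq> []"
  shows "des (a # w) = (if a > hd w then 1 else 0) + des w"
proof -
  let ?D = "{i. Suc i < length w \<and> w ! i > w ! Suc i}"
  have *: "{i. Suc i < length (a # w) \<and> (a # w) ! i > (a # w) ! Suc i}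
      = (if a > hd w then {0} else {}) \<union> Suc ` ?D" (is "?L = ?R")
  proof (rule set_eqI)
    fix i show "i \<in> ?L \<longleftrightarrow> i \<in> ?R"
      using assms by (cases i) (auto simp: hd_conv_nth)
  qed
  have "finite ?D"
    by (rule finite_subset[of _ "{..<length w}"]) auto
  thus ?thesis
    unfolding des_def * by (subst card_Un_disjoint) (auto simp: card_image)
qed

lemma des_less_length: "w \<noteq> [] \<Longrightarrow> des w < length w"
proof (induction w)
  case (Cons a w)
  thus ?case
    by (cases "w = []") (auto simp: des_single des_Cons)
qed simp

text \<open>These are the bounded (P, \<omega>)-partitions of a chain labelled by \<open>w\<close>:
  weakly increasing along \<open>w\<close>, strictly at its descents. The lower bound
  \<open>l\<close> is there for the recursion on the first letter; the value 0 off \<open>w\<close>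
  makes each function determined by its values on \<open>w\<close>.\<close>

definition words_sorted_by :: "nat list \<Rightarrow> nat \<Rightarrow> nat \<Rightarrow> (nat \<Rightarrow> nat) set" where
  "words_sorted_by w l t =
     {c. (\<forall>k. k \<notin> set w \<longrightarrow> c k = 0) \<and> (\<forall>k\<in>set w. l \<le> c k \<and> c k \<le> t) \<and>
         sorted_wrt (key_less c) w}"

text \<open>Split by the value \<open>x\<close> at the first letter. The remaining values are then
  bounded below by \<open>x\<close>, or by \<open>x + 1\<close> if the word begins with a
  descent.\<close>

lemma words_sorted_by_Cons:
  assumes "w \<noteq> []" "a \<notin> set w"
  shows "words_sorted_by (a # w) l t =
    (\<Union>x\<in>{l..t}. (\<lambda>c. c(a := x)) ` words_sorted_by w (x + (if a > hd w then 1 else 0)) t)"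
    (is "_ = (\<Union>x\<in>_. ?U x)")
proof -
  let ?\<delta> = "if a > hd w then 1 else 0 :: nat"
  have upd: "sorted_wrt (key_less (c(a := x))) w \<longleftrightarrow> sorted_wrt (key_less c) w" for c x
  proof -
    have "key_less (c(a := x)) u v \<longleftrightarrow> key_less c u v" if "u \<in> set w" "v \<in> set w" for u v
    proof -
      have "u \<noteq> a" "v \<noteq> a"
        using that assms by auto
      thus ?thesis
        by (simp add: key_less_def)
    qed
    thus ?thesis
      by (intro iffI; elim sorted_wrt_mono_rel[rotated]) auto
  qed
  \<comment> \<open>Only the comparison of \<open>a\<close> with \<open>hd w\<close> matters: a
    later letter has a larger value than \<open>hd w\<close>, or the same value and a larger
    index.\<close>
  have first: "(\<forall>y\<in>set w. key_less c a y) \<longleftrightarrow> (\<forall>y\<in>set w. c a + ?\<delta> \<le> c y)"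
    if "sorted_wrt (key_less c) w" for c
  proof -
    obtain b v where w: "w = b # v"
      using assms by (cases w) auto
    show ?thesis
      using that assms unfolding w by (auto simp: key_less_def)
  qed
  show ?thesis
  proof (intro equalityI subsetI)
    fix c assume c: "c \<in> words_sorted_by (a # w) l t"
    \<comment> \<open>Resetting \<open>c\<close> to 0 at \<open>a\<close> restores the default value
      off \<open>w\<close>.\<close>
    have "c = (c(a := 0))(a := c a)"
      by simp
    moreover have "c(a := 0) \<in> words_sorted_by w (c a + ?\<delta>) t"
    proof -
      have s: "sorted_wrt (key_less c) w" "\<forall>y\<in>set w. key_less c a y" "\<forall>y\<in>set w. c y \<le> t"
        "\<forall>k. k \<notin> set w \<and> k \<noteq> a \<longrightarrow> c k = 0"
        using c by (auto simp: words_sorted_by_def)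
      have "(c(a := 0)) y = c y" if "y \<in> set w" for y
        using that assms(2) by auto
      thus ?thesis
        using s first[OF s(1)] by (simp add: words_sorted_by_def upd del: fun_upd_apply) simp
    qed
    ultimately have "c \<in> ?U (c a)"
      by (rule image_eqI)
    moreover have "c a \<in> {l..t}"
      using c by (auto simp: words_sorted_by_def)
    ultimately show "c \<in> (\<Union>x\<in>{l..t}. ?U x)"
      by blast
  next
    fix c assume "c \<in> (\<Union>x\<in>{l..t}. ?U x)"
    then obtain x c' where x: "x \<in> {l..t}" and c': "c' \<in> words_sorted_by w (x + ?\<delta>) t"
      and c: "c = c'(a := x)"
      by blast
    have s: "sorted_wrt (key_less c) w"
      using c' unfolding c upd by (simp add: words_sorted_by_def)
    have ca: "c a = x" "\<And>k. k \<noteq> a \<Longrightarrow> c k = c' k"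
      by (auto simp: c)
    have w: "c y = c' y" if "y \<in> set w" for y
      using that ca(2)[of y] assms(2) by blast
    have ge: "\<forall>y\<in>set w. c a + ?\<delta> \<le> c y" and "\<forall>y\<in>set w. c y \<le> t"
      "\<forall>k. k \<notin> set w \<and> k \<noteq> a \<longrightarrow> c k = 0"
      using c' by (simp_all add: words_sorted_by_def w ca)
    moreover have "\<forall>y\<in>set w. l \<le> c y"
    proof
      fix y assume "y \<in> set w"
      hence "c a + ?\<delta> \<le> c y"
        using ge by blast
      thus "l \<le> c y"
        using x ca(1) by simp
    qed
    moreover have "l \<le> c a" "c a \<le> t"
      using x ca(1) by auto
    ultimately show "c \<in> words_sorted_by (a # w) l t"
      using s first[OF s] by (simp add: words_sorted_by_def)
  qed
qed

text \<open>The hockey-stick identity; \<open>p \<le> q\<close> makes the right-hand side vanish at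
  \<open>m = 0\<close>.\<close>

lemma sum_binomial_from:
  assumes "p \<le> q"
  shows "(\<Sum>s<m. (s + p) choose q) = (m + p) choose Suc q"
  using assms by (induction m) auto

lemma sum_atLeastAtMost_reflect:
  fixes f :: "nat \<Rightarrow> nat"
  shows "(\<Sum>x\<in>{l..t}. f (t - x)) = (\<Sum>s<Suc t - l. f s)"
  by (rule sum.reindex_bij_witness[of _ "\<lambda>s. t - s" "\<lambda>x. t - x"]) auto

text \<open>Stars and bars: \<open>Suc t - l\<close> values are available, and each of the
  \<open>length w - 1 - des w\<close> ascents permits a repetition, which raises the top of the
  binomial by one. The induction sums over the first value with the hockey-stick identity.\<close>

lemma words_sorted_by_finite_card:
  assumes "distinct w" "w \<noteq> []"
  shows "finite (words_sorted_by w l t) \<and>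
    card (words_sorted_by w l t) = (Suc t - l + (length w - 1 - des w)) choose length w"
  using assms
proof (induction w arbitrary: l)
  case (Cons a w)
  show ?case
  proof (cases "w = []")
    case True
    have "words_sorted_by [a] l t = (\<lambda>x k. if k = a then x else 0) ` {l..t}"
      by (auto simp: words_sorted_by_def image_iff fun_eq_iff)
    moreover have "inj_on (\<lambda>x k. if k = a then x else (0::nat)) {l..t}"
      by (auto simp: inj_on_def fun_eq_iff)
    ultimately show ?thesis
      using True by (simp add: card_image des_single)
  next
    case False
    let ?\<delta> = "if a > hd w then 1 else 0 :: nat"
    let ?U = "\<lambda>x. (\<lambda>c. c(a := x)) ` words_sorted_by w (x + ?\<delta>) t"
    have a: "a \<notin> set w" "distinct w"
      using Cons.prems by auto
    note IH = Cons.IH[OF a(2) False]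
    have inj: "inj_on (\<lambda>c. c(a := x)) (words_sorted_by w l' t)" for x l'
    proof (rule inj_onI)
      fix c c' assume "c \<in> words_sorted_by w l' t" "c' \<in> words_sorted_by w l' t"
        and eq: "c(a := x) = c'(a := x)"
      hence "c a = c' a"
        using a by (auto simp: words_sorted_by_def)
      thus "c = c'"
        using eq by (metis fun_upd_triv fun_upd_upd)
    qed
    have ne: "des w < length w"
      by (rule des_less_length[OF False])
    have "card (\<Union>x\<in>{l..t}. ?U x) = (\<Sum>x\<in>{l..t}. card (?U x))"
    proof (rule card_UN_disjoint)
      have val: "f a = x" if "f \<in> ?U x" for f x
        using that by (elim imageE) simp
      show "\<forall>i\<in>{l..t}. \<forall>j\<in>{l..t}. i \<noteq> j \<longrightarrow> ?U i \<inter> ?U j = {}"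
        using val[OF IntD1] val[OF IntD2] by (intro ballI impI equals0I) metis
    qed (use IH in auto)
    also have "\<dots> = (\<Sum>x\<in>{l..t}. (Suc t - (x + ?\<delta>) + (length w - 1 - des w)) choose length w)"
      by (simp only: card_image[OF inj] IH)
    \<comment> \<open>Since \<open>x \<le> t\<close> and \<open>des w < length w\<close>, no
      subtraction truncates here, and the top is rewritten to depend on \<open>x\<close> only
      through \<open>t - x\<close>.\<close>
    also have "\<dots> = (\<Sum>x\<in>{l..t}. (t - x + (length w - des w - ?\<delta>)) choose length w)"
      using ne by (intro sum.cong refl arg_cong2[where f="(choose)"]) auto
    also have "\<dots> = (\<Sum>s<Suc t - l. (s + (length w - des w - ?\<delta>)) choose length w)"
      by (rule sum_atLeastAtMost_reflect)
    also have "\<dots> = (Suc t - l + (length w - des w - ?\<delta>)) choose Suc (length w)"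
      by (rule sum_binomial_from) simp
    also have "length w - des w - ?\<delta> = length (a # w) - 1 - des (a # w)"
      unfolding des_Cons[OF False] by simp
    finally have "card (\<Union>x\<in>{l..t}. ?U x) =
        (Suc t - l + (length (a # w) - 1 - des (a # w))) choose length (a # w)"
      by (simp only: list.size(4) add_Suc_right add_0_right)
    moreover have "finite (\<Union>x\<in>{l..t}. ?U x)"
      by (intro finite_UN_I finite_imageI finite_atLeastAtMost IH[THEN conjunct1])
    ultimately show ?thesis
      unfolding words_sorted_by_Cons[OF False a(1)] by (rule conjI[rotated])
  qed
qed simp

lemma card_words_sorted_by:
  assumes "distinct w"
  shows "finite (words_sorted_by w 0 t)"
    "card (words_sorted_by w 0 t) = (t + length w - des w) choose length w"
proof -
  have "finite (words_sorted_by w 0 t) \<and>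
    card (words_sorted_by w 0 t) = (t + length w - des w) choose length w"
  proof (cases "w = []")
    case True
    hence "words_sorted_by w 0 t = {\<lambda>_. 0}"
      by (auto simp: words_sorted_by_def)
    thus ?thesis
      using True by simp
  next
    case False
    have "Suc t + (length w - 1 - des w) = t + length w - des w"
      using des_less_length[OF False] by simp
    thus ?thesis
      using words_sorted_by_finite_card[OF assms False, of 0 t] by (simp only: diff_zero)
  qed
  thus "finite (words_sorted_by w 0 t)"
    "card (words_sorted_by w 0 t) = (t + length w - des w) choose length w"
    by auto
qed

section \<open>Prefix sums modulo \<open>t + 1\<close>\<close>

text \<open>The chain starts at \<open>a j - 1\<close>, one before the window
  \<open>{a j..j}\<close>, because the increments in the window lead from the prefix sum at
  \<open>a j - 1\<close> to the one at \<open>j\<close>.\<close>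

definition clockwise_orders :: "nat \<Rightarrow> (nat \<Rightarrow> nat) \<Rightarrow> (nat \<times> nat \<times> nat) set set" where
  "clockwise_orders d a = {\<gamma>. total_cyclic_order {0..d} \<gamma> \<and>
     (\<forall>j\<in>{1..d}. \<forall>u v w. a j - 1 \<le> u \<and> u < v \<and> v < w \<and> w \<le> j \<longrightarrow> (u, v, w) \<in> \<gamma>)}"

lemma finite_clockwise_orders: "finite (clockwise_orders d a)"
  by (rule finite_subset[of _ "Pow ({0..d} \<times> {0..d} \<times> {0..d})"])
    (auto simp: clockwise_orders_def total_cyclic_order_def)

text \<open>The default 0 also covers index 0, so \<open>c 0 = 0\<close> for every word.\<close>

definition words :: "nat \<Rightarrow> nat \<Rightarrow> (nat \<Rightarrow> nat) set" where
  "words d t = {c. \<forall>k. (k \<in> {1..d} \<longrightarrow> c k \<le> t) \<and> (k \<notin> {1..d} \<longrightarrow> c k = 0)}"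

lemma card_eq_sum_card_fibres:
  assumes "finite B" "\<And>b. b \<in> B \<Longrightarrow> finite {x \<in> A. f x = b}"
  shows "card {x \<in> A. f x \<in> B} = (\<Sum>b\<in>B. card {x \<in> A. f x = b})"
proof -
  have "{x \<in> A. f x \<in> B} = (\<Union>b\<in>B. {x \<in> A. f x = b})"
    by blast
  thus ?thesis
    using assms by (simp add: card_UN_disjoint disjoint_iff)
qed

text \<open>Group the words by their cyclic order \<gamma>: each fibre is
  \<open>words_sorted_by\<close> for \<pi>(\<gamma>), whose size is known.\<close>

lemma card_words_clockwise:
  "card {c \<in> words d t. word_cyclic_order d c \<in> clockwise_orders d a} =
    (\<Sum>\<gamma>\<in>clockwise_orders d a. (t + d - des (cyclic_word d \<gamma>)) choose d)"
proof -
  have fibre: "{c \<in> words d t. word_cyclic_order d c = \<gamma>} = words_sorted_by (cyclic_word d \<gamma>) 0 t"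
    and dist: "distinct (cyclic_word d \<gamma>)" "length (cyclic_word d \<gamma>) = d"
    if "\<gamma> \<in> clockwise_orders d a" for \<gamma>
  proof -
    have g: "total_cyclic_order {0..d} \<gamma>"
      using that by (simp add: clockwise_orders_def)
    note w = cyclic_word_props[OF g]
    have eq: "word_cyclic_order d c = \<gamma> \<longleftrightarrow> sorted_wrt (key_less c) (cyclic_word d \<gamma>)"
      if "c \<in> words d t" for c
      by (rule word_cyclic_order_eq_iff[OF g]) (use that in \<open>simp add: words_def\<close>)
    have "{c \<in> words d t. word_cyclic_order d c = \<gamma>} =
        {c \<in> words d t. sorted_wrt (key_less c) (cyclic_word d \<gamma>)}"
      by (intro Collect_cong conj_cong refl eq)
    moreover have "{c \<in> words d t. sorted_wrt (key_less c) v} = words_sorted_by v 0 t"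
      if "set v = {1..d}" for v
      unfolding words_sorted_by_def words_def that by auto
    ultimately show "{c \<in> words d t. word_cyclic_order d c = \<gamma>} = words_sorted_by (cyclic_word d \<gamma>) 0 t"
      using w(2) by (simp only:)
    show "distinct (cyclic_word d \<gamma>)" "length (cyclic_word d \<gamma>) = d"
      using w(1) distinct_card[OF w(1)] unfolding w(2) by simp_all
  qed
  have fin: "finite {c \<in> words d t. word_cyclic_order d c = \<gamma>}" if "\<gamma> \<in> clockwise_orders d a" for \<gamma>
    by (subst fibre[OF that]) (rule card_words_sorted_by(1)[OF dist(1)[OF that]])
  have card: "card {c \<in> words d t. word_cyclic_order d c = \<gamma>} = (t + d - des (cyclic_word d \<gamma>)) choose d"
    if "\<gamma> \<in> clockwise_orders d a" for \<gamma>
    by (subst fibre[OF that]) (simp only: card_words_sorted_by(2)[OF dist(1)[OF that]] dist(2)[OF that])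
  show ?thesis
    by (subst card_eq_sum_card_fibres[OF finite_clockwise_orders fin])
      (auto intro: sum.cong card)
qed

section \<open>Prefix sums on the line and their residues on the circle\<close>

lemma mod_add_less:
  fixes M :: nat
  assumes "\<beta> < M"
  shows "(x + \<beta>) mod M = (if x mod M + \<beta> < M then x mod M + \<beta> else x mod M + \<beta> - M)"
proof -
  define r where "r = x mod M"
  have "r < M"
    using assms by (simp add: r_def)
  hence "(r + \<beta>) mod M = (if r + \<beta> < M then r + \<beta> else r + \<beta> - M)"
    using assms by (simp add: le_mod_geq)
  thus ?thesis
    by (simp add: r_def mod_add_left_eq)
qed

text \<open>Points of the line within less than one full turn keep their order when wrapped around
  the circle. Equal points are allowed if their indices increase.\<close>

lemma word_cyclic_order_mod:
  assumes c: "c x = A mod M" "c y = B mod M" "c z = C mod M"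
    and le: "A \<le> B" "B \<le> C" "C < A + M"
    and strict: "A < B \<or> x < y" "B < C \<or> y < z"
    and d: "x \<le> d" "y \<le> d" "z \<le> d"
  shows "(x, y, z) \<in> word_cyclic_order d c"
proof -
  define \<beta> \<gamma> where "\<beta> = B - A" and "\<gamma> = C - A"
  have B: "B = A + \<beta>" "\<beta> < M" and C: "C = A + \<gamma>" "\<gamma> < M" "\<beta> \<le> \<gamma>"
    using le by (auto simp: \<beta>_def \<gamma>_def)
  define r where "r = A mod M"
  have r: "c x = r" "c y = (if r + \<beta> < M then r + \<beta> else r + \<beta> - M)"
    "c z = (if r + \<gamma> < M then r + \<gamma> else r + \<gamma> - M)"
    unfolding c r_def B(1) C(1) mod_add_less[OF B(2)] mod_add_less[OF C(2)] by (rule refl)+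
  have "r < M"
    using le by (simp add: r_def)
  have xy: "0 < \<beta> \<or> x < y" and yz: "\<beta> < \<gamma> \<or> y < z"
    using strict B(1) C(1) by auto
  \<comment> \<open>The reduction wraps after \<open>z\<close>, between \<open>y\<close> and
    \<open>z\<close>, or between \<open>x\<close> and \<open>y\<close>; each case gives one rotation
    of the chain.\<close>
  consider "r + \<gamma> < M" | "r + \<beta> < M" "M \<le> r + \<gamma>" | "M \<le> r + \<beta>"
    by linarith
  hence "key_less c x y \<and> key_less c y z \<or> key_less c y z \<and> key_less c z x \<or>
      key_less c z x \<and> key_less c x y"
  proof cases
    case 1
    hence "r + \<beta> < M"
      using C(3) by linarith
    with 1 xy yz C(3) have "key_less c x y \<and> key_less c y z"
      unfolding key_less_def r by simp linarith
    thus ?thesis ..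
  next
    case 2
    with xy C(2) have "key_less c z x \<and> key_less c x y"
      unfolding key_less_def r by simp linarith
    thus ?thesis by blast
  next
    case 3
    hence "M \<le> r + \<gamma>"
      using C(3) by linarith
    with 3 yz C(2,3) have "key_less c y z \<and> key_less c z x"
      unfolding key_less_def r by simp linarith
    thus ?thesis by blast
  qed
  thus ?thesis
    using d by (simp add: word_cyclic_order_def)
qed

definition prefix_mod :: "nat \<Rightarrow> nat \<Rightarrow> (nat \<Rightarrow> nat) \<Rightarrow> nat \<Rightarrow> nat" where
  "prefix_mod d t y k = (if k \<le> d then (\<Sum>i=1..k. y i) mod Suc t else 0)"

lemma finite_words: "finite (words d t)"
  using finite_set_of_finite_funs[of "{1..d}" "{..t}" 0] by (simp add: words_def)

lemma prefix_mod_in_words: "prefix_mod d t y \<in> words d t"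
  by (auto simp: words_def prefix_mod_def less_Suc_eq_le[symmetric])

text \<open>Each letter is the difference of consecutive prefix sums modulo \<open>Suc t\<close>,
  and letters up to \<open>t\<close> are determined by their residues.\<close>

lemma inj_on_prefix_mod: "inj_on (prefix_mod d t) (words d t)"
proof (rule inj_onI, rule ext)
  fix y z k
  assume y: "y \<in> words d t" and z: "z \<in> words d t" and eq: "prefix_mod d t y = prefix_mod d t z"
  have S: "(\<Sum>i=1..k. y i) mod Suc t = (\<Sum>i=1..k. z i) mod Suc t" if "k \<le> d" for k
    using fun_cong[OF eq, of k] that by (simp add: prefix_mod_def)
  show "y k = z k"
  proof (cases "k \<in> {1..d}")
    case False
    thus ?thesis
      using y z by (simp add: words_def)
  next
    case True
    then obtain l where l: "k = Suc l"
      by (cases k) auto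
    have "((\<Sum>i=1..l. y i) + y k) mod Suc t = ((\<Sum>i=1..l. z i) + z k) mod Suc t"
      using S[of k] True by (simp add: l)
    also have "\<dots> = ((\<Sum>i=1..l. y i) + z k) mod Suc t"
      using S[of l] True by (intro mod_add_cong) (auto simp: l)
    finally have "((\<Sum>i=1..l. y i) + y k) mod Suc t = ((\<Sum>i=1..l. y i) + z k) mod Suc t" .
    moreover have "y k < Suc t" "z k < Suc t"
      using y z True by (auto simp: words_def)
    ultimately show ?thesis
      by (auto simp: mod_add_less split: if_splits)
  qed
qed

lemma prefix_mod_image: "prefix_mod d t ` words d t = words d t"
  by (rule endo_inj_surj[OF finite_words _ inj_on_prefix_mod]) (auto intro: prefix_mod_in_words)

text \<open>If the window sum is at most \<open>t\<close>, the prefix sums stay within less than one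
  turn and appear clockwise. Otherwise the first step that completes a turn from \<open>b\<close>
  lands between \<open>b\<close> and its predecessor, which breaks the clockwise order.\<close>

lemma prefix_sum_clockwise_iff:
  assumes y: "y \<in> words d t" and bj: "b < j" "j \<le> d"
  shows "(\<Sum>i=Suc b..j. y i) \<le> t \<longleftrightarrow>
    (\<forall>u v w. b \<le> u \<and> u < v \<and> v < w \<and> w \<le> j \<longrightarrow> (u, v, w) \<in> word_cyclic_order d (prefix_mod d t y))"
    (is "_ \<longleftrightarrow> (\<forall>u v w. _ \<longrightarrow> _ \<in> ?\<gamma>)")
proof -
  define S where "S k = (\<Sum>i=1..k. y i)" for k
  have Suc: "S (Suc k) = S k + y (Suc k)" for k
    by (simp add: S_def)
  have mono: "S k \<le> S l" if "k \<le> l" for k l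
    unfolding S_def using that by (intro sum_mono2) auto
  have step: "S k \<le> S (k - 1) + t" if "k \<le> d" for k
    using Suc[of "k - 1"] y that by (cases k) (auto simp: words_def S_def)
  have c: "prefix_mod d t y k = S k mod Suc t" if "k \<le> d" for k
    using that by (simp add: prefix_mod_def S_def)
  have split: "S k = S b + (\<Sum>i=Suc b..k. y i)" if "b \<le> k" for k
    using sum.ub_add_nat[of 1 b y "k - b"] that by (simp add: S_def)
  show ?thesis
  proof
    assume "(\<Sum>i=Suc b..j. y i) \<le> t"
    hence le: "S j \<le> S b + t"
      using split[of j] bj by simp
    show "\<forall>u v w. b \<le> u \<and> u < v \<and> v < w \<and> w \<le> j \<longrightarrow> (u, v, w) \<in> ?\<gamma>"
    proof (intro allI impI)
      fix u v w assume *: "b \<le> u \<and> u < v \<and> v < w \<and> w \<le> j"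
      show "(u, v, w) \<in> ?\<gamma>"
      proof (rule word_cyclic_order_mod[of _ _ "S u" "Suc t" _ "S v" _ "S w"])
        show "S w < S u + Suc t"
          using * le mono[of w j] mono[of b u] by linarith
      qed (use * bj mono c in auto)
    qed
  next
    assume clock: "\<forall>u v w. b \<le> u \<and> u < v \<and> v < w \<and> w \<le> j \<longrightarrow> (u, v, w) \<in> ?\<gamma>"
    have "S k \<le> S b + t" if "b \<le> k" "k \<le> j" for k
      using that
    proof (induction k rule: dec_induct)
      case (step k)
      show ?case
      proof (rule ccontr)
        assume "\<not> S (Suc k) \<le> S b + t"
        hence gt: "S b + Suc t \<le> S (Suc k)"
          by simp
        have k: "S k \<le> S b + t" "S (Suc k) \<le> S k + t" "Suc k \<le> d"
          using step \<open>\<And>k. k \<le> d \<Longrightarrow> S k \<le> S (k - 1) + t\<close>[of "Suc k"] bj by auto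
        \<comment> \<open>A single letter is at most \<open>t\<close>, so the first step out of
          \<open>b\<close> cannot complete a turn.\<close>
        hence "b \<noteq> k"
          using gt by auto
        hence "(b, k, Suc k) \<in> ?\<gamma>"
          using clock step by auto
        \<comment> \<open>Going back one full turn puts the new prefix sum at
          \<open>S (Suc k) - Suc t\<close>, at least \<open>S b\<close> and strictly below
          \<open>S k\<close>.\<close>
        moreover have "(b, Suc k, k) \<in> ?\<gamma>"
        proof (rule word_cyclic_order_mod[of _ _ "S b" "Suc t" _ "S (Suc k) - Suc t" _ "S k"])
          have "S (Suc k) mod Suc t = (S (Suc k) - Suc t + Suc t) mod Suc t"
            using gt by simp
          thus "prefix_mod d t y (Suc k) = (S (Suc k) - Suc t) mod Suc t"
            using c[OF k(3)] by (simp only: mod_add_self2)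
        qed (use c gt k step in auto)
        ultimately show False
          using tco_asym'[OF total_cyclic_order_word] by blast
      qed
    qed simp
    from this[of j] show "(\<Sum>i=Suc b..j. y i) \<le> t"
      using split[of j] bj by simp
  qed
qed

text \<open>\<open>prefix_mod\<close> permutes the words and carries the window bounds to the
  clockwise conditions, so the count by cyclic orders applies.\<close>

lemma card_bounded_window_sums:
  assumes a: "\<And>j. j \<in> {1..d} \<Longrightarrow> 1 \<le> a j \<and> a j \<le> j"
  shows "card {y \<in> words d t. \<forall>j\<in>{1..d}. (\<Sum>i=a j..j. y i) \<le> t} =
    (\<Sum>\<gamma>\<in>clockwise_orders d a. (t + d - des (cyclic_word d \<gamma>)) choose d)"
proof -
  let ?P = "\<lambda>y. \<forall>j\<in>{1..d}. (\<Sum>i=a j..j. y i) \<le> t"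
  let ?Q = "\<lambda>c. word_cyclic_order d c \<in> clockwise_orders d a"
  have iff: "?P y \<longleftrightarrow> ?Q (prefix_mod d t y)" if y: "y \<in> words d t" for y
  proof -
    have "((\<Sum>i=a j..j. y i) \<le> t) \<longleftrightarrow> (\<forall>u v w. a j - 1 \<le> u \<and> u < v \<and> v < w \<and> w \<le> j \<longrightarrow>
        (u, v, w) \<in> word_cyclic_order d (prefix_mod d t y))" if j: "j \<in> {1..d}" for j
    proof -
      have "a j - 1 < j" "Suc (a j - 1) = a j"
        using a[OF j] by linarith+
      thus ?thesis
        using prefix_sum_clockwise_iff[OF y, of "a j - 1" j] j by simp
    qed
    thus ?thesis
      by (simp add: clockwise_orders_def total_cyclic_order_word)
  qed
  have "prefix_mod d t ` {y \<in> words d t. ?P y} = {c \<in> words d t. ?Q c}"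
  proof (intro equalityI subsetI)
    fix c assume "c \<in> prefix_mod d t ` {y \<in> words d t. ?P y}"
    then obtain y where "y \<in> words d t" "?P y" "c = prefix_mod d t y"
      by auto
    thus "c \<in> {c \<in> words d t. ?Q c}"
      using iff[of y] prefix_mod_in_words by simp
  next
    fix c assume c: "c \<in> {c \<in> words d t. ?Q c}"
    then obtain y where "y \<in> words d t" "c = prefix_mod d t y"
      using prefix_mod_image[of d t] by (auto simp: image_iff)
    thus "c \<in> prefix_mod d t ` {y \<in> words d t. ?P y}"
      using iff[of y] c by simp
  qed
  moreover have "card (prefix_mod d t ` {y \<in> words d t. ?P y}) = card {y \<in> words d t. ?P y}"
    by (rule card_image) (rule inj_on_subset[OF inj_on_prefix_mod], blast)
  ultimately show ?thesis
    using card_words_clockwise[of d t a] by simp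
qed

section \<open>\<open>G\<close>-cyclic orders as clockwise orders\<close>

text \<open>The arcs from \<open>k - 1\<close> to \<open>k\<close> inside the window are disjoint and avoid it.\<close>

lemma clockwise_skip_sum_less:
  assumes \<gamma>: "\<gamma> \<in> clockwise_orders d a" and j: "j \<in> {1..d}"
    and a: "\<And>j. j \<in> {1..d} \<Longrightarrow> 1 \<le> a j \<and> a j \<le> j"
  shows "(\<Sum>k\<in>{a j..j}. card {z \<in> {0..<a k}. (k - 1, z, k) \<in> \<gamma>}) < a j"
proof -
  let ?A = "\<lambda>k. {z \<in> {0..<a k}. (k - 1, z, k) \<in> \<gamma>}"
  have tco: "total_cyclic_order {0..d} \<gamma>"
    using \<gamma> by (simp add: clockwise_orders_def)
  note rot = tco_rot[OF tco] and asym = tco_asym'[OF tco] and drop = tco_drop[OF tco]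
  have clock: "(u, v, w) \<in> \<gamma>" if "a j - 1 \<le> u" "u < v" "v < w" "w \<le> j" for u v w
    using \<gamma> j that unfolding clockwise_orders_def by blast
  \<comment> \<open>An element from \<open>a j - 1\<close> on that is below \<open>k - 1\<close>
    precedes \<open>k - 1\<close> and \<open>k\<close> clockwise, hence lies outside the arc from
    \<open>k - 1\<close> to \<open>k\<close>.\<close>
  have less: "z < a j - 1" if k: "k \<in> {a j..j}" and z: "z \<in> ?A k" for k z
  proof (rule ccontr)
    assume "\<not> z < a j - 1"
    moreover have "z < k" "z \<noteq> k - 1"
      using z a[of k] k j a[OF j] tco_distinct[OF tco, of "k - 1" z k] by auto
    ultimately have "(z, k - 1, k) \<in> \<gamma>"
      using k by (intro clock) auto
    hence "(k - 1, k, z) \<in> \<gamma>"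
      by (rule rot)
    thus False
      using z asym by blast
  qed
  have disj: "False" if "k \<in> {a j..j}" "l \<in> {a j..j}" "k < l" "z \<in> ?A k" "z \<in> ?A l" for k l z
  proof -
    have z: "(k - 1, z, k) \<in> \<gamma>" "(l - 1, z, l) \<in> \<gamma>"
      using that by auto
    have k: "1 \<le> k" "a j - 1 \<le> k - 1"
      using that a[OF j] by auto
    have "(k - 1, k, l) \<in> \<gamma>"
      using that k by (intro clock) auto
    hence kl: "(k, l, z) \<in> \<gamma>"
      by (rule rot[OF drop[OF z(1)]])
    have "(l - 1, l, z) \<in> \<gamma>"
    proof (cases "k = l - 1")
      case False
      hence "(k, l - 1, l) \<in> \<gamma>"
        using that k by (intro clock) auto
      thus ?thesis
        by (rule drop[OF _ kl])
    qed (use kl in simp)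
    thus False
      using asym z by blast
  qed
  have "(\<Sum>k\<in>{a j..j}. card (?A k)) = card (\<Union>k\<in>{a j..j}. ?A k)"
  proof (rule card_UN_disjoint[symmetric])
    show "\<forall>k\<in>{a j..j}. \<forall>l\<in>{a j..j}. k \<noteq> l \<longrightarrow> ?A k \<inter> ?A l = {}"
    proof (intro ballI impI equals0I)
      fix k l z assume "k \<in> {a j..j}" "l \<in> {a j..j}" "k \<noteq> l" "z \<in> ?A k \<inter> ?A l"
      thus False
        using disj[of k l z] disj[of l k z] by (cases "k < l") auto
    qed
  qed auto
  \<comment> \<open>The base point \<open>a j - 1\<close> is active but never skipped; this makes
    the final inequality strict.\<close>
  also have "\<dots> \<le> card {0..<a j - 1}"
  proof (intro card_mono finite_atLeastLessThan UN_least subsetI)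
    fix k z assume "k \<in> {a j..j}" "z \<in> ?A k"
    thus "z \<in> {0..<a j - 1}"
      using less[of k z] by simp
  qed
  also have "\<dots> < a j"
    using a[OF j] by simp
  finally show ?thesis .
qed

text \<open>The skip inequalities force the windows to be clockwise by
  \<open>inactive_in_clockwise_order\<close>. Conversely, clockwise windows have disjoint skipping
  arcs, which gives the inequalities, and force the successor of \<open>j\<close> to be
  active.\<close>

lemma common_cyclic_orders_eq_clockwise:
  fixes G :: "'e::finite spinal"
  defines "d \<equiv> num_nonslack G"
  assumes a: "\<And>j. j \<in> {1..d} \<Longrightarrow> 1 \<le> a j \<and> a j \<le> j"
    "\<And>j. j \<in> {1..d} \<Longrightarrow> ACT G j = {0..<a j}"
    "\<And>j. j \<in> {1..d} \<Longrightarrow> INACT G j = {a j..j}"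
    "\<And>i j. i \<in> {1..d} \<Longrightarrow> j \<in> {1..d} \<Longrightarrow> i \<le> j \<Longrightarrow> a i \<le> a j"
  shows "common_cyclic_orders G = clockwise_orders d a"
proof (intro equalityI subsetI)
  fix \<gamma> assume "\<gamma> \<in> common_cyclic_orders G"
  hence \<gamma>: "G_cyclic_order G \<gamma>"
    by (simp add: common_cyclic_orders_def upper_cyclic_orders_def)
  show "\<gamma> \<in> clockwise_orders d a"
    unfolding clockwise_orders_def
    using inactive_in_clockwise_order[OF \<gamma> a[unfolded d_def]] \<gamma>
    unfolding G_cyclic_order_def d_def by blast
next
  fix \<gamma> assume \<gamma>: "\<gamma> \<in> clockwise_orders d a"
  have tco: "total_cyclic_order {0..d} \<gamma>"
    using \<gamma> by (simp add: clockwise_orders_def)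
  have "G_cyclic_order G \<gamma>"
    unfolding G_cyclic_order_def d_def[symmetric]
  proof (intro conjI ballI tco)
    fix j assume j: "j \<in> {1..d}"
    have "skip G \<gamma> k = card {z \<in> {0..<a k}. (k - 1, z, k) \<in> \<gamma>}" if "k \<in> {a j..j}" for k
      using a(2)[of k] that j a(1)[OF j] by (simp add: skip_def)
    thus "(\<Sum>k\<in>INACT G j. skip G \<gamma> k) < card (ACT G j)"
      using clockwise_skip_sum_less[OF \<gamma> j a(1)] a(2,3)[OF j] by simp
  qed
  moreover have "\<exists>y\<in>ACT G j. immediately_before {0..j} \<gamma> j y" if j: "j \<in> {1..d}" for j
  proof -
    have "{0..j} \<subseteq> {0..d}" "j \<in> {0..j}" "{0..j} \<noteq> {j}"
      using j by auto
    then obtain s where s: "immediately_before {0..j} \<gamma> j s"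
      using ex_immediate_successor(1)[OF tco, of "{0..j}" j] by blast
    \<comment> \<open>Were the successor \<open>s\<close> inactive, the active element
      \<open>a j - 1\<close> would come between \<open>j\<close> and \<open>s\<close>.\<close>
    have "s < a j"
    proof (rule ccontr)
      assume "\<not> s < a j"
      hence "a j - 1 \<le> a j - 1 \<and> a j - 1 < s \<and> s < j \<and> j \<le> j"
        using s a(1)[OF j] by (auto simp: immediately_before_def)
      hence "(a j - 1, s, j) \<in> \<gamma>"
        using \<gamma> j unfolding clockwise_orders_def by blast
      hence "(j, a j - 1, s) \<in> \<gamma>"
        using tco_rot[OF tco] by blast
      thus False
        using s a(1)[OF j] by (auto simp: immediately_before_def)
    qed
    thus ?thesis
      using s a(2)[OF j] by auto
  qed
  ultimately show "\<gamma> \<in> common_cyclic_orders G"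
    by (simp add: common_cyclic_orders_def upper_cyclic_orders_def d_def)
qed

section \<open>Lattice points and dimension of the flow polytope\<close>

definition crossing :: "'e::finite spinal \<Rightarrow> nat \<Rightarrow> 'e set" where
  "crossing G i = {e. tail G e \<le> i \<and> i < head G e}"

definition cut_flow :: "'e::finite spinal \<Rightarrow> real ^ 'e \<Rightarrow> nat \<Rightarrow> real" where
  "cut_flow G f i = (\<Sum>e\<in>crossing G i. f $ e)"

text \<open>Both sides sum over the edges that start at, end at or pass over vertex
  \<open>Suc i\<close>.\<close>

lemma cut_flow_Suc:
  assumes "spinal_graph G"
  shows "cut_flow G f (Suc i) + (\<Sum>e | head G e = Suc i. f $ e) =
    cut_flow G f i + (\<Sum>e | tail G e = Suc i. f $ e)"
proof -
  have th: "tail G e < head G e" for e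
    using assms by (auto simp: spinal_graph_def)
  have "cut_flow G f (Suc i) + (\<Sum>e | head G e = Suc i. f $ e) =
      (\<Sum>e\<in>crossing G (Suc i) \<union> {e. head G e = Suc i}. f $ e)"
    unfolding cut_flow_def by (rule sum.union_disjoint[symmetric]) (auto simp: crossing_def)
  also have "crossing G (Suc i) \<union> {e. head G e = Suc i} = crossing G i \<union> {e. tail G e = Suc i}"
  proof (rule set_eqI)
    fix e show "e \<in> crossing G (Suc i) \<union> {e. head G e = Suc i} \<longleftrightarrow> e \<in> crossing G i \<union> {e. tail G e = Suc i}"
      using th[of e] by (auto simp: crossing_def)
  qed
  also have "(\<Sum>e\<in>\<dots>. f $ e) = cut_flow G f i + (\<Sum>e | tail G e = Suc i. f $ e)"
    unfolding cut_flow_def by (rule sum.union_disjoint) (auto simp: crossing_def)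
  finally show ?thesis .
qed

lemma cut_flow_outside:
  assumes "spinal_graph G"
  shows "cut_flow G f 0 = 0" "cut_flow G f (Suc (len G)) = 0"
proof -
  have "e \<notin> crossing G 0 \<and> e \<notin> crossing G (Suc (len G))" for e
  proof -
    have "tail G e \<in> {1..len G + 1}" "head G e \<in> {1..len G + 1}"
      using assms by (auto simp: spinal_graph_def)
    thus ?thesis
      by (simp add: crossing_def)
  qed
  hence "crossing G 0 = {}" "crossing G (Suc (len G)) = {}"
    by blast+
  thus "cut_flow G f 0 = 0" "cut_flow G f (Suc (len G)) = 0"
    by (simp_all add: cut_flow_def)
qed

lemma tail_in_len:
  assumes "spinal_graph G"
  shows "tail G e \<in> {1..len G}"
proof -
  have "tail G e \<in> {1..len G + 1}" "head G e \<in> {1..len G + 1}" "tail G e < head G e"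
    using assms by (auto simp: spinal_graph_def)
  thus ?thesis
    by auto
qed

text \<open>By \<open>cut_flow_Suc\<close>, conservation at a vertex compares the two cuts beside
  it. The unit entering at vertex 1 therefore passes through every cut.\<close>

lemma flow_polytope_eq_cut:
  assumes G: "spinal_graph G"
  shows "flow_polytope G = {f. (\<forall>e. 0 \<le> f $ e) \<and> (\<forall>i\<in>{1..len G}. cut_flow G f i = 1)}"
proof -
  \<comment> \<open>The edge type is inhabited, and any edge has its tail in
    \<open>{1..len G}\<close>. Hence source and sink are different vertices.\<close>
  have n: "1 \<le> len G"
    using tail_in_len[OF G, of undefined] by simp
  have "(\<forall>i\<in>{1..len G + 1}.
            netflow G i + (\<Sum>e | head G e = i. f $ e) = (\<Sum>e | tail G e = i. f $ e)) \<longleftrightarrow>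
        (\<forall>i\<in>{1..len G}. cut_flow G f i = 1)" (is "?L \<longleftrightarrow> ?R") for f
  proof -
    have step: "netflow G (Suc i) + (\<Sum>e | head G e = Suc i. f $ e) = (\<Sum>e | tail G e = Suc i. f $ e) \<longleftrightarrow>
        cut_flow G f (Suc i) = cut_flow G f i + netflow G (Suc i)" for i
      using cut_flow_Suc[OF G, of f i] by linarith
    have all: "?L \<longleftrightarrow> (\<forall>i\<le>len G. cut_flow G f (Suc i) = cut_flow G f i + netflow G (Suc i))"
    proof -
      have I: "{1..len G + 1} = Suc ` {..len G}"
        by (simp add: image_Suc_atMost)
      show ?thesis
        unfolding I step[symmetric] by auto
    qed
    show ?thesis
    proof
      assume ?L
      hence rec: "cut_flow G f (Suc i) = cut_flow G f i + netflow G (Suc i)" if "i \<le> len G" for i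
        using all that by blast
      have "cut_flow G f (Suc i) = 1" if "Suc i \<le> len G" for i
        using that
      proof (induction i)
        case 0
        thus ?case
          using rec[of 0] cut_flow_outside[OF G, of f] by (simp add: netflow_def)
      next
        case (Suc i)
        thus ?case
          using rec[of "Suc i"] by (simp add: netflow_def)
      qed
      thus ?R
        by (metis Suc_le_D atLeastAtMost_iff One_nat_def)
    next
      assume R: ?R
      have "cut_flow G f (Suc i) = cut_flow G f i + netflow G (Suc i)" if i: "i \<le> len G" for i
      proof -
        have c: "cut_flow G f k = (if 1 \<le> k \<and> k \<le> len G then 1 else 0)" if k: "k \<le> Suc (len G)" for k
        proof -
          consider "k = 0" | "k = Suc (len G)" | "k \<in> {1..len G}"
            using k by atomize_elim auto
          thus ?thesis
            by cases (use R cut_flow_outside[OF G, of f] in auto)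
        qed
        show ?thesis
          using c[of i] c[of "Suc i"] i n by (auto simp: netflow_def)
      qed
      thus ?L
        using all by blast
    qed
  qed
  thus ?thesis
    by (simp only: flow_polytope_def)
qed

section \<open>Non-slack coordinates as free parameters, and the dimension\<close>

lemma slack_props:
  assumes "spinal_graph G" "e \<notin> nonslack G"
  shows "slack G (tail G e) = e" "head G e = Suc (tail G e)"
  using assms by (auto simp: spinal_graph_def nonslack_def)

text \<open>A slack edge joins consecutive vertices, so \<open>slack G i\<close> is the only one
  across cut \<open>i\<close>, and the cut equation can be solved for it.\<close>

lemma cut_flow_slack:
  assumes G: "spinal_graph G" and i: "i \<in> {1..len G}"
  shows "cut_flow G f i = f $ slack G i + (\<Sum>e\<in>nonslack G \<inter> crossing G i. f $ e)"
proof -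
  have s: "slack G i \<notin> nonslack G" "tail G (slack G i) = i" "head G (slack G i) = Suc i"
    using G i by (auto simp: spinal_graph_def nonslack_def)
  have "crossing G i = insert (slack G i) (nonslack G \<inter> crossing G i)"
  proof (intro equalityI subsetI)
    fix e assume e: "e \<in> crossing G i"
    show "e \<in> insert (slack G i) (nonslack G \<inter> crossing G i)"
    proof (cases "e \<in> nonslack G")
      case False
      thus ?thesis
        using e slack_props[OF G False] by (auto simp: crossing_def less_Suc_eq_le)
    qed (use e in simp)
  qed (use s in \<open>auto simp: crossing_def\<close>)
  hence "cut_flow G f i = (\<Sum>e\<in>insert (slack G i) (nonslack G \<inter> crossing G i). f $ e)"
    by (simp add: cut_flow_def)
  thus ?thesis
    using s by simp
qed

text \<open>The slack coordinates take what the non-slack edges leave of the total \<open>t\<close>.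
  The total is 1 for the polytope and \<open>t\<close> for its dilates; signs are not constrained
  here.\<close>

definition flow_of :: "'e::finite spinal \<Rightarrow> real \<Rightarrow> ('e \<Rightarrow> real) \<Rightarrow> real ^ 'e" where
  "flow_of G t y = (\<chi> e. if e \<in> nonslack G then y e
     else t - (\<Sum>e'\<in>nonslack G \<inter> crossing G (tail G e). y e'))"

lemma flow_of_nonslack: "e \<in> nonslack G \<Longrightarrow> flow_of G t y $ e = y e"
  and flow_of_slack: "e \<notin> nonslack G \<Longrightarrow>
    flow_of G t y $ e = t - (\<Sum>e'\<in>nonslack G \<inter> crossing G (tail G e). y e')"
  by (simp_all add: flow_of_def)

lemma cut_flow_flow_of:
  assumes G: "spinal_graph G" and i: "i \<in> {1..len G}"
  shows "cut_flow G (flow_of G t y) i = t"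
proof -
  have s: "slack G i \<notin> nonslack G" "tail G (slack G i) = i"
    using G i by (auto simp: spinal_graph_def nonslack_def)
  have "(\<Sum>e\<in>nonslack G \<inter> crossing G i. flow_of G t y $ e) = (\<Sum>e\<in>nonslack G \<inter> crossing G i. y e)"
    by (intro sum.cong) (auto simp: flow_of_nonslack)
  thus ?thesis
    using s by (simp add: cut_flow_slack[OF assms] flow_of_slack)
qed

lemma flow_of_nth:
  assumes G: "spinal_graph G" and f: "\<forall>i\<in>{1..len G}. cut_flow G f i = t"
    and y: "\<And>e. e \<in> nonslack G \<Longrightarrow> f $ e = y e"
  shows "flow_of G t y = f"
proof (rule vec_eq_iff[THEN iffD2, OF allI])
  fix e
  show "flow_of G t y $ e = f $ e"
  proof (cases "e \<in> nonslack G")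
    case True
    thus ?thesis
      by (simp add: flow_of_nonslack y)
  next
    case False
    have "t = f $ e + (\<Sum>e\<in>nonslack G \<inter> crossing G (tail G e). f $ e)"
      using cut_flow_slack[OF G tail_in_len[OF G], of f e] f tail_in_len[OF G, of e] slack_props[OF G False]
      by simp
    also have "(\<Sum>e\<in>nonslack G \<inter> crossing G (tail G e). f $ e) =
        (\<Sum>e\<in>nonslack G \<inter> crossing G (tail G e). y e)"
      by (intro sum.cong) (auto simp: y)
    finally show ?thesis
      using False by (simp add: flow_of_slack)
  qed
qed

text \<open>A flow is an affine function of its non-slack coordinates, and the polytope contains the
  points where these are 0 or a unit vector.\<close>

lemma aff_dim_flow_polytope:
  assumes G: "spinal_graph G"
  shows "aff_dim (flow_polytope G) = int (num_nonslack G)"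
proof -
  let ?P = "flow_polytope G" and ?N = "nonslack G"
  \<comment> \<open>\<open>f0\<close> runs along the slack path; for non-slack \<open>e\<close>,
    \<open>v e\<close> replaces the slack edges below \<open>e\<close> by \<open>e\<close>. In the
    non-slack coordinates, the differences \<open>v e - f0\<close> are the standard basis.\<close>
  define f0 where "f0 = flow_of G 1 (\<lambda>_. 0)"
  define v where "v e = flow_of G 1 (\<lambda>e'. if e' = e then 1 else 0)" for e
  have f0: "f0 \<in> ?P"
  proof -
    have "0 \<le> f0 $ e" for e
      by (simp add: f0_def flow_of_def)
    thus ?thesis
      using cut_flow_flow_of[OF G] by (simp add: flow_polytope_eq_cut[OF G] f0_def)
  qed
  have v: "v e \<in> ?P" for e
  proof -
    have "0 \<le> v e $ c" for c
      by (simp add: v_def flow_of_def)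
    thus ?thesis
      using cut_flow_flow_of[OF G] by (simp add: flow_polytope_eq_cut[OF G] v_def)
  qed
  have nth: "(v e - f0) $ c = (if c \<in> ?N then if c = e then 1 else 0
      else if e \<in> crossing G (tail G c) then -1 else 0)" if "e \<in> ?N" for e c
    using that by (simp add: v_def f0_def flow_of_def)
  have comb: "(\<Sum>e\<in>?N. u e *\<^sub>R (v e - f0)) $ c = u c" if "c \<in> ?N" for u c
  proof -
    have "(\<Sum>e\<in>?N. u e *\<^sub>R (v e - f0)) $ c = (\<Sum>e\<in>?N. if e = c then u e else 0)"
      unfolding sum_component using that nth by (intro sum.cong) auto
    thus ?thesis
      using that by simp
  qed
  have inj: "inj_on (\<lambda>e. v e - f0) ?N"
  proof (rule inj_onI)
    fix e e' assume *: "e \<in> ?N" "e' \<in> ?N" "v e - f0 = v e' - f0"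
    have "(v e - f0) $ e = (v e' - f0) $ e"
      by (simp only: *(3))
    thus "e = e'"
      unfolding nth[OF *(1)] nth[OF *(2)] using * by (auto split: if_splits)
  qed
  have "aff_dim ?P = int (dim ((+) (- f0) ` ?P))"
    by (rule aff_dim_eq_dim) (rule hull_inc[OF f0])
  also have "dim ((+) (- f0) ` ?P) = num_nonslack G"
  proof (rule dim_unique)
    show "(\<lambda>e. v e - f0) ` ?N \<subseteq> (+) (- f0) ` ?P"
      using v by auto
    show "card ((\<lambda>e. v e - f0) ` ?N) = num_nonslack G"
      using inj by (simp add: card_image num_nonslack_def)
    show "independent ((\<lambda>e. v e - f0) ` ?N)"
    proof (rule independent_if_scalars_zero)
      fix u x assume 0: "(\<Sum>x\<in>(\<lambda>e. v e - f0) ` ?N. u x *\<^sub>R x) = 0" and "x \<in> (\<lambda>e. v e - f0) ` ?N"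
      then obtain e where e: "e \<in> ?N" "x = v e - f0"
        by blast
      have "(\<Sum>e\<in>?N. u (v e - f0) *\<^sub>R (v e - f0)) = 0"
        using 0 inj by (simp add: sum.reindex)
      thus "u x = 0"
        using comb[OF e(1), of "\<lambda>e. u (v e - f0)"] e(2) by simp
    qed simp
    show "(+) (- f0) ` ?P \<subseteq> span ((\<lambda>e. v e - f0) ` ?N)"
    proof
      fix x assume "x \<in> (+) (- f0) ` ?P"
      then obtain f where f: "f \<in> ?P" "x = - f0 + f"
        by blast
      hence cut: "\<forall>i\<in>{1..len G}. cut_flow G f i = 1"
        unfolding flow_polytope_eq_cut[OF G] by blast
      have "x = (\<Sum>e\<in>?N. (f $ e) *\<^sub>R (v e - f0))"
      proof (rule vec_eq_iff[THEN iffD2, OF allI])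
        fix c
        show "x $ c = (\<Sum>e\<in>?N. (f $ e) *\<^sub>R (v e - f0)) $ c"
        proof (cases "c \<in> ?N")
          case True
          thus ?thesis
            unfolding comb[OF True] by (simp add: f(2) f0_def flow_of_nonslack)
        next
          case False
          have "(\<Sum>e\<in>?N. (f $ e) *\<^sub>R (v e - f0)) $ c =
              (\<Sum>e\<in>?N. if e \<in> crossing G (tail G c) then - (f $ e) else 0)"
            unfolding sum_component using False nth by (intro sum.cong) auto
          also have "\<dots> = - (\<Sum>e\<in>?N \<inter> crossing G (tail G c). f $ e)"
            by (subst sum.inter_restrict[symmetric]) (simp_all add: sum_negf)
          also have "\<dots> = flow_of G 1 (\<lambda>e. f $ e) $ c - 1"
            using False by (simp add: flow_of_slack)
          also have "\<dots> = x $ c"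
            using False flow_of_nth[OF G cut] by (simp add: f(2) f0_def flow_of_slack)
          finally show ?thesis ..
        qed
      qed
      thus "x \<in> span ((\<lambda>e. v e - f0) ` ?N)"
        by (simp only:) (intro span_sum span_scale span_base imageI)
    qed
  qed
  finally show ?thesis .
qed

section \<open>Lattice points of the dilates as words with bounded window sums\<close>

lemma scaled_lattice_points_eq:
  assumes G: "spinal_graph G" and t: "t \<noteq> 0"
  shows "{x \<in> (\<lambda>v. real t *\<^sub>R v) ` flow_polytope G. \<forall>e. x $ e \<in> \<int>} =
    {x. (\<forall>e. 0 \<le> x $ e \<and> x $ e \<in> \<int>) \<and> (\<forall>i\<in>{1..len G}. cut_flow G x i = real t)}"
proof -
  have scale: "cut_flow G (r *\<^sub>R x) i = r * cut_flow G x i" for r x i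
    by (simp add: cut_flow_def sum_distrib_left)
  have "x \<in> (\<lambda>v. real t *\<^sub>R v) ` flow_polytope G \<longleftrightarrow>
      (\<forall>e. 0 \<le> x $ e) \<and> (\<forall>i\<in>{1..len G}. cut_flow G x i = real t)" for x
  proof
    assume "x \<in> (\<lambda>v. real t *\<^sub>R v) ` flow_polytope G"
    thus "(\<forall>e. 0 \<le> x $ e) \<and> (\<forall>i\<in>{1..len G}. cut_flow G x i = real t)"
      unfolding flow_polytope_eq_cut[OF G] by (auto simp: scale)
  next
    assume x: "(\<forall>e. 0 \<le> x $ e) \<and> (\<forall>i\<in>{1..len G}. cut_flow G x i = real t)"
    have "inverse (real t) *\<^sub>R x \<in> flow_polytope G"
      unfolding flow_polytope_eq_cut[OF G] using x t by (auto simp: scale)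
    moreover have "x = real t *\<^sub>R (inverse (real t) *\<^sub>R x)"
      using t by simp
    ultimately show "x \<in> (\<lambda>v. real t *\<^sub>R v) ` flow_polytope G"
      by (metis imageI)
  qed
  thus ?thesis
    by auto
qed

lemma sum_nonslack_crossing:
  fixes g :: "'e::finite \<Rightarrow> real"
  assumes "spinal_graph G"
  shows "(\<Sum>e\<in>nonslack G \<inter> crossing G i. g e) =
    (\<Sum>k | k \<in> {1..num_nonslack G} \<and> lab G k \<in> crossing G i. g (lab G k))"
proof -
  have bij: "bij_betw (lab G) {1..num_nonslack G} (nonslack G)"
    using assms by (auto simp: spinal_graph_def canonical_labeling_def)
  have eq: "nonslack G \<inter> crossing G i = lab G ` {k. k \<in> {1..num_nonslack G} \<and> lab G k \<in> crossing G i}"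
    by (subst bij_betw_imp_surj_on[OF bij, symmetric]) blast
  have inj: "inj_on (lab G) {k. k \<in> {1..num_nonslack G} \<and> lab G k \<in> crossing G i}"
    by (rule inj_on_subset[OF bij_betw_imp_inj_on[OF bij]]) blast
  show ?thesis
    unfolding eq sum.reindex[OF inj] comp_def ..
qed

text \<open>\<open>INACT G j\<close> lies in the crossing set at the tail of edge \<open>j\<close>,
  and the crossing set at \<open>i\<close> lies in \<open>INACT G j\<close> for the last
  \<open>j\<close> with tail at most \<open>i\<close>. Nonnegativity then compares the sums.\<close>

lemma crossing_sums_le_iff:
  fixes g :: "nat \<Rightarrow> real"
  assumes G: "spinal_graph G" and nonneg: "\<And>k. 0 \<le> g k" and t: "0 \<le> t"
  shows "(\<forall>i\<in>{1..len G}. (\<Sum>k | k \<in> {1..num_nonslack G} \<and> lab G k \<in> crossing G i. g k) \<le> t) \<longleftrightarrow>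
    (\<forall>j\<in>{1..num_nonslack G}. (\<Sum>k\<in>INACT G j. g k) \<le> t)"
proof -
  let ?d = "num_nonslack G"
  let ?C = "\<lambda>i. {k. k \<in> {1..?d} \<and> lab G k \<in> crossing G i}"
  have tmono: "tail G (lab G j) \<le> tail G (lab G k)" if "j \<in> {1..?d}" "k \<in> {1..?d}" "j \<le> k" for j k
    using G that by (fastforce simp: spinal_graph_def canonical_labeling_def edge_lex_le_def)
  show ?thesis
  proof (intro iffI ballI)
    fix j assume C: "\<forall>i\<in>{1..len G}. (\<Sum>k\<in>?C i. g k) \<le> t" and j: "j \<in> {1..?d}"
    have "INACT G j \<subseteq> ?C (tail G (lab G j))"
      using tmono j by (auto simp: INACT_def crossing_def)
    hence "(\<Sum>k\<in>INACT G j. g k) \<le> (\<Sum>k\<in>?C (tail G (lab G j)). g k)"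
      by (intro sum_mono2) (auto intro: nonneg)
    also have "\<dots> \<le> t"
      using C tail_in_len[OF G] by blast
    finally show "(\<Sum>k\<in>INACT G j. g k) \<le> t" .
  next
    fix i assume I: "\<forall>j\<in>{1..?d}. (\<Sum>k\<in>INACT G j. g k) \<le> t"
    define K where "K = {k \<in> {1..?d}. tail G (lab G k) \<le> i}"
    show "(\<Sum>k\<in>?C i. g k) \<le> t"
    proof (cases "K = {}")
      case True
      hence C: "?C i = {}"
        by (auto simp: K_def crossing_def)
      show ?thesis
        unfolding C using t by simp
    next
      case False
      have fin: "finite K"
        by (simp add: K_def)
      define j where "j = Max K"
      have j: "j \<in> {1..?d}" "tail G (lab G j) \<le> i" and max: "\<And>k. k \<in> K \<Longrightarrow> k \<le> j"
        using Max_in[OF fin False] Max_ge[OF fin] by (auto simp: j_def K_def)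
      have "?C i \<subseteq> INACT G j"
        using j max by (fastforce simp: INACT_def crossing_def K_def)
      hence "(\<Sum>k\<in>?C i. g k) \<le> (\<Sum>k\<in>INACT G j. g k)"
        by (intro sum_mono2) (auto simp: INACT_def intro: nonneg)
      thus ?thesis
        using I j(1) by fastforce
    qed
  qed
qed

text \<open>Reading off the non-slack coordinates is a bijection with inverse
  \<open>flow_of\<close>; nonnegativity of the slack coordinates becomes the window bounds.\<close>

lemma lattice_count_flow_polytope:
  fixes G :: "'e::finite spinal"
  defines "d \<equiv> num_nonslack G"
  assumes G: "spinal_graph G" and t: "t \<noteq> 0"
  shows "lattice_count (flow_polytope G) t =
    card {y \<in> words d t. \<forall>j\<in>{1..d}. (\<Sum>k\<in>INACT G j. y k) \<le> t}"
proof -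
  define X where "X = {x :: real ^ 'e. (\<forall>e. 0 \<le> x $ e \<and> x $ e \<in> \<int>) \<and>
    (\<forall>i\<in>{1..len G}. cut_flow G x i = real t)}"
  define Y where "Y = {y \<in> words d t. \<forall>j\<in>{1..d}. (\<Sum>k\<in>INACT G j. y k) \<le> t}"
  define ind where "ind = the_inv_into {1..d} (lab G)"
  \<comment> \<open>On \<open>X\<close> the coordinates are nonnegative integers, so
    \<open>nat\<close> and floor change nothing; the default 0 matches \<open>words\<close>.\<close>
  define \<Phi> where "\<Phi> x k = (if k \<in> {1..d} then nat \<lfloor>x $ lab G k\<rfloor> else 0)" for x :: "real ^ 'e" and k
  define \<Psi> where "\<Psi> y = flow_of G (real t) (\<lambda>e. real (y (ind e)))" for y
  have bij: "bij_betw (lab G) {1..d} (nonslack G)"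
    using G by (auto simp: spinal_graph_def canonical_labeling_def d_def)
  hence lab: "lab G k \<in> nonslack G" "ind (lab G k) = k" if "k \<in> {1..d}" for k
    using that unfolding ind_def by (auto simp: bij_betw_def intro: the_inv_into_f_f)
  have inv: "ind e \<in> {1..d}" "lab G (ind e) = e"
    if "e \<in> nonslack G" for e
    using that bij unfolding ind_def using f_the_inv_into_f_bij_betw[OF bij] the_inv_into_into[of "lab G" "{1..d}" e "{1..d}"]
    by (auto simp: bij_betw_def)
  have C: "(\<Sum>e\<in>nonslack G \<inter> crossing G i. real (y (ind e))) =
      (\<Sum>k | k \<in> {1..d} \<and> lab G k \<in> crossing G i. real (y k))" for y :: "nat \<Rightarrow> nat" and i
    unfolding sum_nonslack_crossing[OF G] d_def[symmetric] by (intro sum.cong) (auto simp: lab)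
  have window: "(\<forall>j\<in>{1..d}. (\<Sum>k\<in>INACT G j. y k) \<le> t) \<longleftrightarrow>
      (\<forall>i\<in>{1..len G}. (\<Sum>k | k \<in> {1..d} \<and> lab G k \<in> crossing G i. real (y k)) \<le> real t)" for y
    using crossing_sums_le_iff[OF G, of "\<lambda>k. real (y k)" "real t"]
    unfolding d_def[symmetric] of_nat_sum[symmetric] of_nat_le_iff by simp
  have real_\<Phi>: "real (\<Phi> x k) = x $ lab G k" if "x \<in> X" "k \<in> {1..d}" for x k
    using that by (auto simp: X_def \<Phi>_def elim!: Ints_cases)
  have "bij_betw \<Phi> X Y"
  proof (rule bij_betw_byWitness[of _ \<Psi>])
    show "\<forall>x\<in>X. \<Psi> (\<Phi> x) = x"
    proof
      fix x assume x: "x \<in> X"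
      show "\<Psi> (\<Phi> x) = x"
        unfolding \<Psi>_def
        by (rule flow_of_nth[OF G]) (use x real_\<Phi>[OF x inv(1)] inv(2) in \<open>auto simp: X_def\<close>)
    qed
    show "\<forall>y\<in>Y. \<Phi> (\<Psi> y) = y"
    proof (intro ballI ext)
      fix y k assume y: "y \<in> Y"
      show "\<Phi> (\<Psi> y) k = y k"
        using y by (cases "k \<in> {1..d}") (auto simp: \<Phi>_def \<Psi>_def flow_of_nonslack lab Y_def words_def)
    qed
    show "\<Phi> ` X \<subseteq> Y"
    proof
      fix y assume "y \<in> \<Phi> ` X"
      then obtain x where x: "x \<in> X" "y = \<Phi> x"
        by blast
      have le: "(\<Sum>k | k \<in> {1..d} \<and> lab G k \<in> crossing G i. real (y k)) \<le> real t"
        if i: "i \<in> {1..len G}" for i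
      proof -
        have "(\<Sum>k | k \<in> {1..d} \<and> lab G k \<in> crossing G i. real (y k)) =
            (\<Sum>e\<in>nonslack G \<inter> crossing G i. x $ e)"
          unfolding sum_nonslack_crossing[OF G] d_def[symmetric]
          by (intro sum.cong) (auto simp: x real_\<Phi>)
        also have "\<dots> = real t - x $ slack G i"
          using cut_flow_slack[OF G i, of x] x(1) i by (simp add: X_def)
        also have "\<dots> \<le> real t"
          using x(1) by (simp add: X_def)
        finally show ?thesis .
      qed
      hence w: "\<forall>j\<in>{1..d}. (\<Sum>k\<in>INACT G j. y k) \<le> t"
        using window by blast
      \<comment> \<open>The bound on single letters follows from the window bounds, since
        \<open>k\<close> is inactive at itself.\<close>
      have "y k \<le> t" if k: "k \<in> {1..d}" for k
      proof -
        have "tail G (lab G k) < head G (lab G k)"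
          using G by (auto simp: spinal_graph_def)
        hence "k \<in> INACT G k"
          using k by (auto simp: INACT_def)
        hence "y k \<le> (\<Sum>l\<in>INACT G k. y l)"
          by (intro member_le_sum) (auto simp: INACT_def)
        thus ?thesis
          using w k by fastforce
      qed
      moreover have "y k = 0" if "k \<notin> {1..d}" for k
        unfolding x(2) \<Phi>_def by (rule if_not_P[OF that])
      ultimately show "y \<in> Y"
        using w by (auto simp: Y_def words_def)
    qed
    show "\<Psi> ` Y \<subseteq> X"
    proof
      fix x assume "x \<in> \<Psi> ` Y"
      then obtain y where y: "y \<in> Y" "x = \<Psi> y"
        by blast
      have "0 \<le> x $ e \<and> x $ e \<in> \<int>" for e
      proof (cases "e \<in> nonslack G")
        case True
        thus ?thesis
          by (simp add: y \<Psi>_def flow_of_nonslack)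
      next
        case False
        have "(\<Sum>k | k \<in> {1..d} \<and> lab G k \<in> crossing G (tail G e). real (y k)) \<le> real t"
          using y(1) window[of y] tail_in_len[OF G, of e] by (auto simp: Y_def)
        thus ?thesis
          using False by (auto simp: y(2) \<Psi>_def flow_of_slack C intro!: Ints_diff Ints_sum)
      qed
      thus "x \<in> X"
        using cut_flow_flow_of[OF G] by (simp add: X_def y(2) \<Psi>_def)
    qed
  qed
  hence "card X = card Y"
    by (rule bij_betw_same_card)
  thus ?thesis
    unfolding lattice_count_def scaled_lattice_points_eq[OF G t] X_def Y_def .
qed

section \<open>The Ehrhart series\<close>

text \<open>The negative binomial series shifted by \<open>n\<close>. For \<open>t < n\<close> the
  binomial vanishes because \<open>n \<le> d\<close> gives \<open>t + d - n < d\<close>.\<close>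

lemma fps_nth_monom_divide:
  assumes "n \<le> d"
  shows "fps_nth (fps_X ^ n * inverse ((1 - fps_X) ^ Suc d) :: real fps) t = real ((t + d - n) choose d)"
proof -
  have "inverse ((1 - fps_X) ^ Suc d) = Abs_fps (\<lambda>k. real ((Suc d + k - 1) choose k))"
    using one_minus_const_fps_X_neg_power'[of "Suc d" "1 :: real"] by simp
  hence "fps_nth (fps_X ^ n * inverse ((1 - fps_X) ^ Suc d) :: real fps) t =
      (if t < n then 0 else real ((t - n + d) choose (t - n)))"
    unfolding fps_X_power_mult_nth by (simp add: add.commute)
  also have "\<dots> = real ((t + d - n) choose d)"
  proof (cases "t < n")
    case True
    hence "t + d - n < d"
      using assms by linarith
    thus ?thesis
      using True by simp
  next
    case False
    thus ?thesis
      using binomial_symmetric[of d "t - n + d"] by simp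
  qed
  finally show ?thesis .
qed

theorem theorem7p4:
  fixes G :: "'e::finite spinal"
  assumes "spinal_graph G" and "non_nested G"
  shows "is_hstar_polynomial (flow_polytope G)
           (\<Sum>\<gamma>\<in>common_cyclic_orders G. monom 1 (des (cyclic_word (num_nonslack G) \<gamma>)))"
proof -
  let ?d = "num_nonslack G" and ?A = "common_cyclic_orders G"
  let ?des = "\<lambda>\<gamma>. des (cyclic_word ?d \<gamma>)"
  obtain a where a: "\<And>j. j \<in> {1..?d} \<Longrightarrow> 1 \<le> a j \<and> a j \<le> j"
    "\<And>j. j \<in> {1..?d} \<Longrightarrow> ACT G j = {0..<a j}"
    "\<And>j. j \<in> {1..?d} \<Longrightarrow> INACT G j = {a j..j}"
    "\<And>i j. i \<in> {1..?d} \<Longrightarrow> j \<in> {1..?d} \<Longrightarrow> i \<le> j \<Longrightarrow> a i \<le> a j"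
    using ACT_INACT_if_non_nested[OF assms] by metis
  have A: "?A = clockwise_orders ?d a"
    by (rule common_cyclic_orders_eq_clockwise[OF a])
  define N where "N t = card {y \<in> words ?d t. \<forall>j\<in>{1..?d}. (\<Sum>i=a j..j. y i) \<le> t}" for t
  have N: "N t = (\<Sum>\<gamma>\<in>?A. (t + ?d - ?des \<gamma>) choose ?d)" for t
    unfolding N_def A by (rule card_bounded_window_sums[OF a(1)])
  \<comment> \<open>The Ehrhart series has constant term 1 by convention; the only word for
    \<open>t = 0\<close> matches it, so one coefficient formula covers all \<open>t\<close>.\<close>
  have "words ?d 0 = {\<lambda>_. 0}"
    by (auto simp: words_def fun_eq_iff)
  hence "{y \<in> words ?d 0. \<forall>j\<in>{1..?d}. (\<Sum>i=a j..j. y i) \<le> 0} = {\<lambda>_. 0}"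
    by auto
  hence N0: "N 0 = 1"
    by (simp add: N_def)
  have coeff: "fps_nth (ehrhart_series (flow_polytope G)) t = real (N t)" for t
    using N0 lattice_count_flow_polytope[OF assms(1), of t] a(3)
    by (simp add: ehrhart_series_def N_def cong: conj_cong)
  have des_le: "?des \<gamma> \<le> ?d" if "\<gamma> \<in> ?A" for \<gamma>
  proof -
    have tco: "total_cyclic_order {0..?d} \<gamma>"
      using that by (simp add: A clockwise_orders_def)
    have "length (cyclic_word ?d \<gamma>) = ?d"
      using distinct_card[OF cyclic_word_props(1)[OF tco]] unfolding cyclic_word_props(2)[OF tco] by simp
    thus ?thesis
      using des_less_length[of "cyclic_word ?d \<gamma>"] by (cases "cyclic_word ?d \<gamma> = []") (simp_all add: des_Nil)
  qed
  have "ehrhart_series (flow_polytope G) = (\<Sum>\<gamma>\<in>?A. fps_X ^ ?des \<gamma> * inverse ((1 - fps_X) ^ Suc ?d))"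
    by (rule fps_ext) (simp only: coeff N of_nat_sum fps_sum_nth fps_nth_monom_divide des_le cong: sum.cong)
  also have "\<dots> = fps_of_poly (\<Sum>\<gamma>\<in>?A. monom 1 (?des \<gamma>)) / (1 - fps_X) ^ Suc ?d"
    by (simp add: fps_of_poly_sum fps_of_poly_monom' fps_divide_unit sum_distrib_right del: power_Suc)
  finally show ?thesis
    by (simp add: is_hstar_polynomial_def aff_dim_flow_polytope[OF assms(1)] nat_add_distrib)
qed

end
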